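(* Let $n\ge 1$ and let $\Lambda$ be a lattice of full rank in $\mathbb{R}^n$. Assume that $B \ge 8 n^{n/2}\,\nu(\Lambda)$ and $B_1 \ge 8 n^2 (n+1) B$. Suppose $n$ vectors are selected uniformly at random from $\Lambda\cap[0,B)^n$ and $n+1$ vectors are selected uniformly at random from $\Lambda\cap[0,B_1)^n$, all $2n+1$ vectors being sampled independently. Then the probability that these $2n+1$ vectors generate $\Lambda$ (as an abelian group) is at least \[ \alpha_n := \Biggl( \prod_{i=2}^{n+1} \zeta(i)^{-1} - \tfrac14 \Biggr)\cdot \prod_{k=0}^{n-1}\biggl(1 - n^{k/2}\,\frac{(4n^{n/2}+1)^k}{(4n^{n/2}-1)^n}\biggr) \ \ge\ 0.092. \]
   Context: A lattice of full rank in $\mathbb{R}^n$ is a discrete subgroup of $\mathbb{R}^n$ spanning $\mathbb{R}^n$. The covering radius $\nu(\Lambda)$ is $\sup_{x\in\mathbb{R}^n}\min_{\lambda\in\Lambda}\|x-\lambda\|_2$. $\zeta$ denotes the Riemann zeta function. Sampling "uniformly at random" from a finite set means with respect to the uniform distribution on that set. *)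

theory Defs
  imports "HOL-Analysis.Analysis" "HOL-Probability.Probability"
begin

definition full_rank_lattice :: "('a::euclidean_space) set \<Rightarrow> bool" where
  "full_rank_lattice L \<longleftrightarrow>
     0 \<in> L \<and> (\<forall>x\<in>L. \<forall>y\<in>L. x + y \<in> L) \<and> (\<forall>x\<in>L. - x \<in> L) \<and>
     (\<exists>e>0. \<forall>x\<in>L. x \<noteq> 0 \<longrightarrow> e \<le> norm x) \<and>
     span L = UNIV"

definition covering_radius :: "('a::euclidean_space) set \<Rightarrow> real" where
  "covering_radius L = (SUP x. INF l\<in>L. norm (x - l))"

definition add_subgroup_generated :: "('a::ab_group_add) set \<Rightarrow> 'a set" where
  "add_subgroup_generated V =
     \<Inter> {H. 0 \<in> H \<and> (\<forall>x\<in>H. \<forall>y\<in>H. x + y \<in> H) \<and> (\<forall>x\<in>H. - x \<in> H) \<and> V \<subseteq> H}"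

definition zeta_real :: "real \<Rightarrow> real" where
  "zeta_real s = (\<Sum>m. 1 / (real (Suc m)) powr s)"

definition box0 :: "real \<Rightarrow> (real ^ 'n) set" where
  "box0 B = {x. \<forall>i. 0 \<le> x $ i \<and> x $ i < B}"

definition alpha_const :: "nat \<Rightarrow> real" where
  "alpha_const n =
     ((\<Prod>i=2..n+1. 1 / zeta_real (real i)) - 1/4) *
     (\<Prod>k<n. 1 - real n powr (real k / 2) *
        (4 * real n powr (real n / 2) + 1) ^ k / (4 * real n powr (real n / 2) - 1) ^ n)"

end

theory Submission
  imports Defs
begin

text \<open>
  Up to null sets the translates of the Voronoi cell of the lattice tile space, and the cell lies in
  the ball whose radius is the covering radius. Comparing volumes therefore counts the lattice points
  in a cube, and also those in a proper subspace, since there the cells lie in a thin slab around the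
  subspace. Choosing the first \<open>n\<close> vectors one after the other, this bounds the probability that they
  are linearly independent.

  If they are, they span a sublattice \<open>H\<close> of finite index with a fundamental parallelepiped inside
  \<open>[0, nB]\<^sup>n\<close>. As \<open>B\<^sub>1\<close> is large compared with \<open>nB\<close>, almost all lattice points of the big cube lie
  in translates of the parallelepiped that are contained in the cube, and on these points the class modulo
  \<open>H\<close> is equidistributed. It remains to see that \<open>n + 1\<close> uniform elements of a finite abelian
  group with generators \<open>b\<^sub>1, \<dots>, b\<^sub>n\<close> generate it with probability at least
  \<open>1 / (\<zeta>(2) \<cdots> \<zeta>(n+1))\<close>. By induction on \<open>n\<close>: modulo the subgroup \<open>K\<close> generated by the first
  \<open>n - 1\<close> generators the elements are multiples of \<open>b\<^sub>n\<close>, whose coefficients are jointly coprime to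
  the order of \<open>b\<^sub>n\<close> with probability at least \<open>1 / \<zeta>(n+1)\<close>; Euclid's algorithm then reduces to the
  case that a single coefficient is nonzero, in which it suffices that the other \<open>n\<close> elements
  generate \<open>K\<close>.
\<close>

section \<open>Zeta values and tuples coprime to a modulus\<close>

lemma zeta_real_sums:
  assumes "k \<ge> 2"
  shows "(\<lambda>m. 1 / real (Suc m) ^ k) sums zeta_real (real k)"
proof -
  have "summable (\<lambda>m. inverse (real m ^ k))"
    using assms by (rule inverse_power_summable)
  then have "summable (\<lambda>m. inverse (real (Suc m) ^ k))"
    by (subst summable_Suc_iff)
  then have "(\<lambda>m. 1 / real (Suc m) ^ k) sums (\<Sum>m. 1 / real (Suc m) ^ k)"
    by (simp add: summable_sums inverse_eq_divide)
  also have "(\<Sum>m. 1 / real (Suc m) ^ k) = zeta_real (real k)"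
    unfolding zeta_real_def by (simp add: powr_realpow del: of_nat_Suc)
  finally show ?thesis .
qed

lemma zeta_real_has_sum:
  assumes "k \<ge> 2"
  shows "((\<lambda>n. 1 / real n ^ k) has_sum zeta_real (real k)) {0<..}"
proof -
  have "((\<lambda>m. 1 / real (Suc m) ^ k) has_sum zeta_real (real k)) UNIV"
    using zeta_real_sums[OF assms] by (intro sums_nonneg_imp_has_sum) auto
  then have "(((\<lambda>n. 1 / real n ^ k) \<circ> Suc) has_sum zeta_real (real k)) UNIV"
    by (simp add: o_def)
  moreover have "range Suc = {0<..}"
    by (auto simp: image_iff gr0_conv_Suc)
  ultimately show ?thesis
    using has_sum_reindex[of Suc UNIV "\<lambda>n. 1 / real n ^ k"] by simp
qed

text \<open>Sieve form of the Euler product. Among the numbers that survive the primes in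
  \<open>F\<close>, the multiples of a further prime \<open>p\<close> are exactly \<open>p\<close>
  times the survivors, so their sum is \<open>1 / p ^ k\<close> times the whole, and removing them
  multiplies the sum by \<open>1 - 1 / p ^ k\<close>.\<close>

lemma zeta_real_euler_sieve:
  assumes k: "k \<ge> 2" and F: "finite F" "\<And>p. p \<in> F \<Longrightarrow> prime p"
  shows "((\<lambda>n. 1 / real n ^ k) has_sum (zeta_real (real k) * (\<Prod>p\<in>F. 1 - 1 / real p ^ k)))
           {n. 0 < n \<and> (\<forall>p\<in>F. \<not> p dvd n)}"
  using F
proof (induction F rule: finite_induct)
  case empty
  then show ?case using zeta_real_has_sum[OF k] by (simp add: greaterThan_def)
next
  case (insert p F)
  let ?f = "\<lambda>n. 1 / real n ^ k"
  let ?S = "zeta_real (real k) * (\<Prod>p\<in>F. 1 - 1 / real p ^ k)"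
  define A where "A = {n. 0 < n \<and> (\<forall>q\<in>F. \<not> q dvd n)}"
  have p: "prime p" "p > 0" using insert.prems by (auto intro: prime_gt_0_nat)
  have IH: "(?f has_sum ?S) A"
    unfolding A_def using insert by auto
  have img: "(*) p ` A = {n \<in> A. p dvd n}"
  proof -
    have "\<not> q dvd p * n" if "q \<in> F" "\<not> q dvd n" for q n
    proof -
      have "prime q" "q \<noteq> p" using that insert by auto
      then show ?thesis using that p prime_dvd_mult_nat primes_dvd_imp_eq by metis
    qed
    then have "p * n \<in> A" if "n \<in> A" for n
      using that p by (simp add: A_def)
    moreover have "n \<in> (*) p ` A" if n: "n \<in> A" "p dvd n" for n
    proof -
      obtain m where m: "n = p * m" using n by (rule_tac dvdE)
      then have "m \<in> A" using n by (auto simp: A_def)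
      then show ?thesis using m by blast
    qed
    ultimately show ?thesis by auto
  qed
  have "((\<lambda>n. 1 / real p ^ k * ?f n) has_sum (1 / real p ^ k * ?S)) A"
    by (intro has_sum_cmult_right IH)
  then have "((?f \<circ> (*) p) has_sum (1 / real p ^ k * ?S)) A"
    by (simp add: o_def power_mult_distrib)
  then have "(?f has_sum (1 / real p ^ k * ?S)) {n \<in> A. p dvd n}"
    using has_sum_reindex[of "(*) p" A ?f] p by (simp add: img inj_on_def)
  then have "(?f has_sum (?S - 1 / real p ^ k * ?S)) (A - {n \<in> A. p dvd n})"
    by (intro has_sum_Diff IH) auto
  moreover have "A - {n \<in> A. p dvd n} = {n. 0 < n \<and> (\<forall>q\<in>insert p F. \<not> q dvd n)}"
    by (auto simp: A_def)
  moreover have "?S - 1 / real p ^ k * ?S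
      = zeta_real (real k) * (\<Prod>p\<in>insert p F. 1 - 1 / real p ^ k)"
    using insert.hyps by (simp add: algebra_simps)
  ultimately show ?case by simp
qed

lemma zeta_real_ge_partial_sum:
  assumes "k \<ge> 2"
  shows "(\<Sum>m<N. 1 / real (Suc m) ^ k) \<le> zeta_real (real k)"
  using zeta_real_sums[OF assms] by (intro sum_le_suminf[THEN order_trans]) (auto simp: sums_iff)

lemma zeta_real_ge_1: "k \<ge> 2 \<Longrightarrow> zeta_real (real k) \<ge> 1"
  using zeta_real_ge_partial_sum[of k 1] by simp

text \<open>The number 1 survives every sieve and contributes 1 to the sieved sum, which is
  \<open>zeta_real k\<close> times the finite product.\<close>

lemma inverse_zeta_le_euler_product:
  assumes k: "k \<ge> 2" and F: "finite F" "\<And>p. p \<in> F \<Longrightarrow> prime p"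
  shows "1 / zeta_real (real k) \<le> (\<Prod>p\<in>F. 1 - 1 / real p ^ k)"
proof -
  have "((\<lambda>n. 1 / real n ^ k) has_sum 1) {1::nat}"
    by (rule has_sum_finiteI) auto
  then have "1 \<le> zeta_real (real k) * (\<Prod>p\<in>F. 1 - 1 / real p ^ k)"
    by (rule has_sum_mono_neutral[OF _ zeta_real_euler_sieve[OF assms]])
       (auto dest: F(2) simp: prime_nat_iff)
  then show ?thesis
    using zeta_real_ge_1[OF k] by (simp add: field_simps)
qed

text \<open>Inclusion-exclusion one prime at a time. The tuples killed by a new prime
  \<open>p\<close> are \<open>p\<close> times the tuples over \<open>{..<c div p}\<close>;
  divisibility by the other primes of \<open>F\<close> is unaffected by the factor \<open>p\<close>.
  The modulus changes from \<open>c\<close> to \<open>c div p\<close>, hence the induction over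
  arbitrary \<open>c\<close>.\<close>

lemma card_sieved_tuples:
  assumes F: "finite F" "\<And>p. p \<in> F \<Longrightarrow> prime p" and "finite I" "I \<noteq> {}"
    and "c > 0" "\<Prod>F dvd c"
  shows "real (card {a \<in> PiE I (\<lambda>_. {..<c}). \<forall>p\<in>F. \<exists>i\<in>I. \<not> p dvd a i})
           = real c ^ card I * (\<Prod>p\<in>F. 1 - 1 / real p ^ card I)"
  using F \<open>c > 0\<close> \<open>\<Prod>F dvd c\<close>
proof (induction F arbitrary: c rule: finite_induct)
  case empty
  then show ?case using \<open>finite I\<close> by (simp add: card_PiE)
next
  case (insert p F c)
  define S where "S = (\<lambda>c. {a \<in> PiE I (\<lambda>_. {..<c::nat}). \<forall>p\<in>F. \<exists>i\<in>I. \<not> p dvd a i})"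
  let ?D = "{a \<in> S c. \<forall>i\<in>I. p dvd a i}"
  have p: "prime p" "p > 0" using insert.prems by (auto intro: prime_gt_0_nat)
  have dvd: "p * \<Prod>F dvd c" using insert by simp
  then obtain c' where c': "c = p * c'" by (metis dvd_mult_left dvdE)
  have c'0: "c' > 0" and Fc': "\<Prod>F dvd c'" using c' insert.prems p dvd by auto
  have Fc: "\<Prod>F dvd c" using dvd by (rule dvd_mult_right)
  have IH: "real (card (S x)) = real x ^ card I * (\<Prod>p\<in>F. 1 - 1 / real p ^ card I)"
    if "x > 0" "\<Prod>F dvd x" for x
    unfolding S_def using insert that by auto
  have ndvd: "\<not> q dvd p" if "q \<in> F" for q
    using that insert p primes_dvd_imp_eq by (metis insertCI)
  have "bij_betw (\<lambda>a. \<lambda>i\<in>I. p * a i) (S c') ?D"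
  proof (rule bij_betw_byWitness[where f' = "\<lambda>a. \<lambda>i\<in>I. a i div p"])
    show "\<forall>a\<in>S c'. (\<lambda>i\<in>I. (\<lambda>i\<in>I. p * a i) i div p) = a"
      using p by (auto simp: S_def fun_eq_iff PiE_iff extensional_def restrict_def)
    show "\<forall>a\<in>?D. (\<lambda>i\<in>I. p * (\<lambda>i\<in>I. a i div p) i) = a"
      using p by (auto simp: S_def fun_eq_iff PiE_iff extensional_def restrict_def)
    show "(\<lambda>a. \<lambda>i\<in>I. p * a i) ` S c' \<subseteq> ?D"
    proof (intro image_subsetI CollectI conjI ballI)
      fix a assume a: "a \<in> S c'"
      have "\<exists>i\<in>I. \<not> q dvd p * a i" if q: "q \<in> F" for q
      proof -
        obtain i where i: "i \<in> I" "\<not> q dvd a i" using a q by (auto simp: S_def)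
        moreover have "prime q" using q insert.prems by simp
        ultimately show ?thesis using ndvd[OF q] by (metis prime_dvd_mult_iff)
      qed
      then show "(\<lambda>i\<in>I. p * a i) \<in> S c"
        using a p(2) unfolding c' S_def by (simp add: PiE_iff)
    qed simp
    show "(\<lambda>a. \<lambda>i\<in>I. a i div p) ` ?D \<subseteq> S c'"
    proof
      fix x assume "x \<in> (\<lambda>a. \<lambda>i\<in>I. a i div p) ` ?D"
      then obtain a where a: "a \<in> ?D" "x = (\<lambda>i\<in>I. a i div p)" by (rule imageE)
      have "\<exists>i\<in>I. \<not> q dvd x i" if q: "q \<in> F" for q
      proof -
        obtain i where i: "i \<in> I" "\<not> q dvd a i" using a(1) q unfolding S_def by blast
        have "p dvd a i" using a(1) i(1) by blast
        then have "a i = p * x i" unfolding a(2) using i(1) by (simp only: restrict_apply' dvd_mult_div_cancel)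
        then show ?thesis using i dvd_mult[of q "x i" p] by auto
      qed
      then show "x \<in> S c'"
        using a(1) unfolding a(2) S_def
        by (auto simp: PiE_iff c' mult.commute[of p] intro: less_mult_imp_div_less)
    qed
  qed
  then have cD: "card ?D = card (S c')" by (simp add: bij_betw_same_card)
  have fin: "finite (S c)" 
    unfolding S_def 
    by (rule finite_subset[OF _ finite_PiE[OF \<open>finite I\<close>, of "\<lambda>_. {..<c}"]]) auto
  have eq: "{a \<in> PiE I (\<lambda>_. {..<c}). \<forall>p\<in>insert p F. \<exists>i\<in>I. \<not> p dvd a i} = S c - ?D"
    by (auto simp: S_def)
  have "real (card {a \<in> PiE I (\<lambda>_. {..<c}). \<forall>p\<in>insert p F. \<exists>i\<in>I. \<not> p dvd a i})
       = real (card (S c)) - real (card (S c'))"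
  proof -
    have sub: "?D \<subseteq> S c" by blast
    have "card (S c - ?D) = card (S c) - card ?D"
      using finite_subset[OF sub fin] sub by (intro card_Diff_subset)
    then show ?thesis
      unfolding eq using card_mono[OF fin sub] cD by (simp only: of_nat_diff)
  qed
  also have "\<dots> = real c ^ card I * (\<Prod>p\<in>insert p F. 1 - 1 / real p ^ card I)"
  proof -
    have "real c ^ card I = real p ^ card I * real c' ^ card I"
      by (simp add: c' power_mult_distrib)
    then have "real c' ^ card I = real c ^ card I * (1 / real p ^ card I)"
      using p by simp
    then show ?thesis
      unfolding IH[OF insert.prems(2) Fc] IH[OF c'0 Fc'] prod.insert[OF insert.hyps]
      by (simp only: algebra_simps)
  qed
  finally show ?case .
qed

text \<open>The sieve is run over the prime factors of \<open>c\<close>, whose product, the radical,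
  divides \<open>c\<close>; the resulting finite Euler product is at least
  \<open>1 / zeta_real (card I)\<close>.\<close>

lemma card_coprime_tuples_ge:
  assumes "finite I" "card I \<ge> 2" "c > 0"
  shows "real c ^ card I / zeta_real (real (card I))
     \<le> real (card {a \<in> PiE I (\<lambda>_. {..<c}). \<forall>p. prime p \<longrightarrow> p dvd c \<longrightarrow> (\<exists>i\<in>I. \<not> p dvd a i)})"
proof -
  have "\<Prod>(prime_factors c) dvd (\<Prod>p\<in>prime_factors c. p ^ multiplicity p c)"
    by (intro prod_dvd_prod) (auto simp: prime_factors_multiplicity)
  then have "\<Prod>(prime_factors c) dvd c"
    using prime_factorization_nat[OF \<open>c > 0\<close>] by simp
  moreover have "{a \<in> PiE I (\<lambda>_. {..<c}). \<forall>p. prime p \<longrightarrow> p dvd c \<longrightarrow> (\<exists>i\<in>I. \<not> p dvd a i)}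
      = {a \<in> PiE I (\<lambda>_. {..<c}). \<forall>p\<in>prime_factors c. \<exists>i\<in>I. \<not> p dvd a i}"
    using \<open>c > 0\<close> by (auto simp: prime_factors_dvd)
  moreover have "I \<noteq> {}" using assms by auto
  ultimately have "real (card {a \<in> PiE I (\<lambda>_. {..<c}). \<forall>p. prime p \<longrightarrow> p dvd c \<longrightarrow> (\<exists>i\<in>I. \<not> p dvd a i)})
     = real c ^ card I * (\<Prod>p\<in>prime_factors c. 1 - 1 / real p ^ card I)"
    using assms card_sieved_tuples[of "prime_factors c" I c] by auto
  also have "\<dots> \<ge> real c ^ card I * (1 / zeta_real (real (card I)))"
    using assms by (intro mult_left_mono inverse_zeta_le_euler_product) auto
  finally show ?thesis by simp
qed

section \<open>Generating tuples in finite quotients\<close>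

definition add_subgroup :: "'a::ab_group_add set \<Rightarrow> bool" where
  "add_subgroup H \<longleftrightarrow> 0 \<in> H \<and> (\<forall>x\<in>H. \<forall>y\<in>H. x + y \<in> H) \<and> (\<forall>x\<in>H. - x \<in> H)"

lemma add_subgroup_diff: "add_subgroup H \<Longrightarrow> x \<in> H \<Longrightarrow> y \<in> H \<Longrightarrow> x - y \<in> H"
  unfolding add_subgroup_def by (metis diff_conv_add_uminus)

lemma add_subgroup_add: "add_subgroup H \<Longrightarrow> x \<in> H \<Longrightarrow> y \<in> H \<Longrightarrow> x + y \<in> H"
  by (simp add: add_subgroup_def)

lemma add_subgroup_minus: "add_subgroup H \<Longrightarrow> x \<in> H \<Longrightarrow> - x \<in> H"
  by (simp add: add_subgroup_def)

lemma add_subgroup_0: "add_subgroup H \<Longrightarrow> 0 \<in> H"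
  by (simp add: add_subgroup_def)

lemma add_subgroup_sum: "add_subgroup H \<Longrightarrow> (\<And>i. i \<in> I \<Longrightarrow> f i \<in> H) \<Longrightarrow> sum f I \<in> H"
  by (induction I rule: infinite_finite_induct) (auto simp: add_subgroup_def)

lemma add_subgroup_scaleR_nat:
  fixes x :: "'a::real_vector"
  assumes "add_subgroup H" "x \<in> H"
  shows "real n *\<^sub>R x \<in> H"
  by (induction n) (use assms in \<open>auto simp: add_subgroup_def algebra_simps\<close>)

lemma add_subgroup_scaleR_int:
  fixes x :: "'a::real_vector"
  assumes "add_subgroup H" "x \<in> H"
  shows "of_int z *\<^sub>R x \<in> H"
proof (cases "z \<ge> 0")
  case True
  then show ?thesis using add_subgroup_scaleR_nat[OF assms, of "nat z"] by simp
next
  case False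
  then have "of_int z *\<^sub>R x = - (real (nat (- z)) *\<^sub>R x)" by simp
  then show ?thesis
    using add_subgroup_scaleR_nat[OF assms] add_subgroup_minus[OF assms(1)] by metis
qed

lemma add_subgroup_generated_eq_hull: "add_subgroup_generated V = add_subgroup hull V"
  unfolding add_subgroup_generated_def hull_def add_subgroup_def by (rule arg_cong[where f = Inter]) auto

lemma add_subgroup_generated [intro!, simp]: "add_subgroup (add_subgroup_generated V)"
  unfolding add_subgroup_generated_def add_subgroup_def by auto

lemma subset_add_subgroup_generated: "V \<subseteq> add_subgroup_generated V"
  unfolding add_subgroup_generated_eq_hull by (rule hull_subset)

lemma add_subgroup_generated_minimal:
  "V \<subseteq> K \<Longrightarrow> add_subgroup K \<Longrightarrow> add_subgroup_generated V \<subseteq> K"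
  unfolding add_subgroup_generated_eq_hull by (rule hull_minimal)

lemma add_subgroup_generated_eqI:
  assumes "V \<subseteq> add_subgroup_generated W" "W \<subseteq> add_subgroup_generated V"
  shows "add_subgroup_generated V = add_subgroup_generated W"
  using assms by (intro subset_antisym add_subgroup_generated_minimal) auto

lemma add_subgroup_generated_insert:
  fixes b :: "'a::real_vector"
  assumes K: "add_subgroup K"
  shows "add_subgroup_generated (insert b K) = {x + of_int z *\<^sub>R b |x z. x \<in> K}"
proof
  let ?M = "{x + of_int z *\<^sub>R b |x z. x \<in> K}"
  have "add_subgroup ?M"
    unfolding add_subgroup_def
  proof (intro conjI ballI)
    show "0 \<in> ?M" using add_subgroup_0[OF K] by (intro CollectI exI[of _ 0]) auto
    fix u assume "u \<in> ?M"
    then obtain x z where u: "u = x + of_int z *\<^sub>R b" "x \<in> K" by auto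
    have "- u = - x + of_int (- z) *\<^sub>R b" using u by simp
    then show "- u \<in> ?M" using add_subgroup_minus[OF K u(2)] by blast
    fix v assume "v \<in> ?M"
    then obtain y w where v: "v = y + of_int w *\<^sub>R b" "y \<in> K" by auto
    have "u + v = (x + y) + of_int (z + w) *\<^sub>R b"
      using u v by (simp add: algebra_simps)
    then show "u + v \<in> ?M" using add_subgroup_add[OF K u(2) v(2)] by blast
  qed
  moreover have "insert b K \<subseteq> ?M"
  proof (intro insert_subsetI subsetI)
    have "b = 0 + of_int 1 *\<^sub>R b" by simp
    then show "b \<in> ?M" using add_subgroup_0[OF K] by blast
    fix x assume "x \<in> K"
    moreover have "x = x + of_int 0 *\<^sub>R b" by simp
    ultimately show "x \<in> ?M" by blast
  qed
  ultimately show "add_subgroup_generated (insert b K) \<subseteq> ?M"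
    by (intro add_subgroup_generated_minimal)
  show "?M \<subseteq> add_subgroup_generated (insert b K)"
    using subset_add_subgroup_generated[of "insert b K"]
    by (auto intro!: add_subgroup_add add_subgroup_scaleR_int)
qed

text \<open>Models a quotient by \<open>H\<close> inside the ambient space: \<open>rho\<close>
  selects one element of each coset of \<open>H\<close>, so classes are counted as fixed points of
  \<open>rho\<close>.\<close>

locale quotient_representatives =
  fixes H :: "'a::real_vector set" and rho :: "'a \<Rightarrow> 'a"
  assumes H: "add_subgroup H"
    and diff_rho: "\<And>x. x - rho x \<in> H"
    and rho_eqI: "\<And>x y. x - y \<in> H \<Longrightarrow> rho x = rho y"
begin

text \<open>For a subgroup \<open>K\<close> containing \<open>H\<close> this is a transversal of
  \<open>K / H\<close>, hence its cardinality is the index of \<open>H\<close> in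
  \<open>K\<close>.\<close>

definition reps :: "'a set \<Rightarrow> 'a set" where
  "reps K = {x \<in> K. rho x = x}"

lemma rho_idem [simp]: "rho (rho x) = rho x"
  by (rule rho_eqI) (metis H add_subgroup_minus diff_rho minus_diff_eq)

lemma rho_eq_iff: "rho x = rho y \<longleftrightarrow> x - y \<in> H"
proof
  assume "rho x = rho y"
  then have "x - y = (x - rho x) - (y - rho y)" by simp
  then show "x - y \<in> H" using add_subgroup_diff[OF H] diff_rho by metis
qed (rule rho_eqI)

lemma mem_iff_of_diff:
  assumes "add_subgroup K" "H \<subseteq> K" "x - y \<in> H"
  shows "x \<in> K \<longleftrightarrow> y \<in> K"
proof -
  have "x - y \<in> K" using assms by auto
  then show ?thesis
    using add_subgroup_add[OF assms(1), of "x - y" y] add_subgroup_diff[OF assms(1), of x "x - y"] by auto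
qed

lemma rho_mem_iff:
  assumes "add_subgroup K" "H \<subseteq> K"
  shows "rho x \<in> K \<longleftrightarrow> x \<in> K"
  using mem_iff_of_diff[OF assms diff_rho] by auto

lemma rho_in_reps: "add_subgroup K \<Longrightarrow> H \<subseteq> K \<Longrightarrow> x \<in> K \<Longrightarrow> rho x \<in> reps K"
  unfolding reps_def by (simp add: rho_mem_iff)

lemma reps_subset: "reps K \<subseteq> K"
  by (auto simp: reps_def)

lemma reps_eqI: "x \<in> reps K \<Longrightarrow> y \<in> reps K \<Longrightarrow> x - y \<in> H \<Longrightarrow> x = y"
  unfolding reps_def by (metis (mono_tags, lifting) rho_eqI mem_Collect_eq)

text \<open>The preimage of the subgroup of the quotient generated by the classes of the
  \<open>y i\<close>; by \<open>gen_cong\<close> it depends on these classes only.\<close>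

definition gen :: "'i set \<Rightarrow> ('i \<Rightarrow> 'a) \<Rightarrow> 'a set" where
  "gen I y = add_subgroup_generated (H \<union> y ` I)"

lemma subgroup_gen [simp, intro!]: "add_subgroup (gen I y)"
  by (simp add: gen_def)

lemma H_subset_gen: "H \<subseteq> gen I y"
  unfolding gen_def using subset_add_subgroup_generated[of "H \<union> y ` I"] by blast

lemma gen_mem: "i \<in> I \<Longrightarrow> y i \<in> gen I y"
  unfolding gen_def using subset_add_subgroup_generated[of "H \<union> y ` I"] by blast

lemma gen_subset_iff:
  assumes "add_subgroup K" "H \<subseteq> K"
  shows "gen I y \<subseteq> K \<longleftrightarrow> (\<forall>i\<in>I. y i \<in> K)"
  using assms gen_mem[of _ I y] add_subgroup_generated_minimal[of "H \<union> y ` I" K]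
  unfolding gen_def by blast

lemma gen_eqI:
  assumes "\<And>i. i \<in> I \<Longrightarrow> y i \<in> gen J z" "\<And>i. i \<in> J \<Longrightarrow> z i \<in> gen I y"
  shows "gen I y = gen J z"
  using assms by (intro subset_antisym) (auto simp: gen_subset_iff H_subset_gen)

lemma gen_cong:
  assumes "\<And>i. i \<in> I \<Longrightarrow> y i - z i \<in> H"
  shows "gen I y = gen I z"
proof (rule gen_eqI)
  fix i assume i: "i \<in> I"
  show "y i \<in> gen I z"
    using mem_iff_of_diff[OF subgroup_gen H_subset_gen assms[OF i]] gen_mem[OF i] by metis
  show "z i \<in> gen I y"
    using mem_iff_of_diff[OF subgroup_gen H_subset_gen assms[OF i]] gen_mem[OF i] by metis
qed

section \<open>Counting generating tuples of a finite quotient\<close>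

lemma card_generating_translate_ge:
  fixes K :: "'a set" and b :: 'a and c :: nat and a :: "'i \<Rightarrow> nat" and M :: real
  assumes I: "finite I" "I \<noteq> {}" and K: "add_subgroup K" "H \<subseteq> K" and fin: "finite (reps K)"
    and c: "real c *\<^sub>R b \<in> K" "c > 0"
    and cop: "\<And>p. prime p \<Longrightarrow> p dvd c \<Longrightarrow> \<exists>i\<in>I. \<not> p dvd a i"
    and M: "\<And>i. i \<in> I \<Longrightarrow> M \<le> real (card {r \<in> PiE (I - {i}) (\<lambda>_. reps K). gen (I - {i}) r = K})"
  shows "real (card (reps K)) * M
    \<le> real (card {r \<in> PiE I (\<lambda>_. reps K).
          gen I (\<lambda>i. r i + real (a i) *\<^sub>R b) = add_subgroup_generated (insert b K)})"
  using cop
  \<comment> \<open>subtractive Euclid on \<open>a\<close>: replacing \<open>y i\<close> by \<open>y i - y j\<close> permutes the tuples and preserves \<open>gen\<close>\<close>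
proof (induction "sum a I" arbitrary: a rule: less_induct)
  case less
  let ?K' = "add_subgroup_generated (insert b K)"
  define G where "G = (\<lambda>a::'i \<Rightarrow> nat. {r \<in> PiE I (\<lambda>_. reps K). gen I (\<lambda>i. r i + real (a i) *\<^sub>R b) = ?K'})"
  have finPi: "finite (PiE I (\<lambda>_. reps K))"
    using I fin by (intro finite_PiE)
  have finG: "finite (G a)" for a
    unfolding G_def by (rule finite_subset[OF _ finPi]) blast
  have K': "add_subgroup ?K'" "b \<in> ?K'" "K \<subseteq> ?K'"
    using subset_add_subgroup_generated[of "insert b K"] by auto
  consider (single) i where "i \<in> I" "\<And>j. j \<in> I \<Longrightarrow> j \<noteq> i \<Longrightarrow> a j = 0"
    | (pair) i j where "i \<in> I" "j \<in> I" "i \<noteq> j" "0 < a j" "a j \<le> a i"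
  proof -
    \<comment> \<open>Choosing \<open>i\<close> with maximal coefficient guarantees
      \<open>a j <= a i\<close>, so the natural number subtraction \<open>a i - a j\<close> in the
      second case is exact.\<close>
    have "Max (a ` I) \<in> a ` I" using I by (intro Max_in) auto
    then obtain i where i: "i \<in> I" "a i = Max (a ` I)" by force
    then have le: "a j \<le> a i" if "j \<in> I" for j using I that by simp
    show ?thesis
    proof (cases "\<exists>j\<in>I. j \<noteq> i \<and> 0 < a j")
      case True
      then obtain j where "j \<in> I" "j \<noteq> i" "0 < a j" by blast
      then show ?thesis using pair[of i j] i le by blast
    next
      case False
      then show ?thesis by (intro single[of i] i(1)) auto
    qed
  qed
  then show ?case
  proof cases
    case single
    let ?A = "{r \<in> PiE (I - {i}) (\<lambda>_. reps K). gen (I - {i}) r = K}"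
    \<comment> \<open>End of the Euclidean descent: all other coefficients are 0, so
      \<open>cop\<close> makes \<open>a i\<close> coprime to \<open>c\<close>. If the entries other
      than \<open>i\<close> generate \<open>K\<close>, then any \<open>x\<close> may stand at
      position \<open>i\<close>: both \<open>a i\<close> times \<open>b\<close> and \<open>c\<close>
      times \<open>b\<close> are generated, and Bezout recovers \<open>b\<close> itself. This gives
      \<open>card (reps K)\<close> choices of \<open>x\<close> for each of at least \<open>M\<close>
      tuples.\<close>
    have "coprime (a i) c"
    proof (rule ccontr)
      assume "\<not> coprime (a i) c"
      then obtain p where p: "prime p" "p dvd a i" "p dvd c"
        using c(2) by (metis coprime_iff_gcd_eq_1 prime_factor_nat gcd_dvd1 gcd_dvd2 dvd_trans)
      then obtain l where "l \<in> I" "\<not> p dvd a l" using less.prems by blast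
      then show False using p single(2)[of l] by (cases "l = i") auto
    qed
    then have "coprime (int (a i)) (int c)" by simp
    then obtain u v where uv: "u * int (a i) + v * int c = 1"
      using bezout_int[of "int (a i)" "int c"] by auto
    have "(\<lambda>(x, r). r(i := x)) ` (reps K \<times> ?A) \<subseteq> G a"
    proof (rule image_subsetI)
      fix xr assume "xr \<in> reps K \<times> ?A"
      then obtain x r where xr: "xr = (x, r)" and x: "x \<in> reps K"
        and r: "r \<in> PiE (I - {i}) (\<lambda>_. reps K)" and gK: "K = gen (I - {i}) r"
        by blast
      let ?r = "r(i := x)"
      let ?y = "\<lambda>l. ?r l + real (a l) *\<^sub>R b"
      have r1: "?r \<in> PiE I (\<lambda>_. reps K)"
        using r x single by (auto simp: PiE_iff extensional_def)
      have sub: "K \<subseteq> gen I ?y"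
      proof -
        have "r l \<in> gen I ?y" if "l \<in> I - {i}" for l
          using gen_mem[of l I ?y] that single by auto
        then show ?thesis
          unfolding gK by (simp add: gen_subset_iff[OF subgroup_gen H_subset_gen])
      qed
      have xK: "x \<in> K" using x reps_subset by blast
      have "real (a i) *\<^sub>R b \<in> gen I ?y"
        using add_subgroup_diff[OF subgroup_gen gen_mem[of i I ?y], of x] single xK sub by auto
      moreover have "real c *\<^sub>R b \<in> gen I ?y" using c sub by auto
      ultimately have "of_int u *\<^sub>R (real (a i) *\<^sub>R b) + of_int v *\<^sub>R (real c *\<^sub>R b) \<in> gen I ?y"
        by (intro add_subgroup_add add_subgroup_scaleR_int) auto
      also have "of_int u *\<^sub>R (real (a i) *\<^sub>R b) + of_int v *\<^sub>R (real c *\<^sub>R b)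
          = of_int (u * int (a i) + v * int c) *\<^sub>R b"
        by (simp add: algebra_simps)
      finally have "b \<in> gen I ?y" using uv by simp
      then have "?K' \<subseteq> gen I ?y"
        using sub by (intro add_subgroup_generated_minimal) auto
      moreover have "gen I ?y \<subseteq> ?K'"
      proof (subst gen_subset_iff[OF K'(1)])
        show "H \<subseteq> ?K'" using K K' by blast
        show "\<forall>l\<in>I. ?y l \<in> ?K'"
        proof
          fix l assume "l \<in> I"
          then have "?r l \<in> K" using r1 reps_subset by blast
          then have "?r l \<in> ?K'" using K' by blast
          then show "?y l \<in> ?K'"
            using K' by (intro add_subgroup_add add_subgroup_scaleR_nat)
        qed
      qed
      ultimately have "?r \<in> G a" using r1 by (auto simp: G_def)
      then show "(case xr of (x, r) \<Rightarrow> r(i := x)) \<in> G a" by (simp add: xr)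
    qed
    moreover have "inj_on (\<lambda>(x, r). r(i := x)) (reps K \<times> ?A)"
    proof (rule inj_onI)
      fix u w assume uw: "u \<in> reps K \<times> ?A" "w \<in> reps K \<times> ?A"
        "(case u of (x, r) \<Rightarrow> r(i := x)) = (case w of (x, r) \<Rightarrow> r(i := x))"
      obtain x r x' r' where xr: "u = (x, r)" "w = (x', r')" by (cases u, cases w)
      with uw have *: "r \<in> PiE (I - {i}) (\<lambda>_. reps K)" "r' \<in> PiE (I - {i}) (\<lambda>_. reps K)"
        "r(i := x) = r'(i := x')" by auto
      then have "x = x'" by (metis fun_upd_same)
      moreover have "r = r'"
      proof
        fix l show "r l = r' l"
        proof (cases "l = i")
          case True
          then show ?thesis using *(1,2) by (simp add: PiE_iff extensional_def)
        next
          case False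
          then show ?thesis using *(3) by (metis fun_upd_other)
        qed
      qed
      ultimately show "u = w" by (simp add: xr)
    qed
    ultimately have "card (reps K \<times> ?A) \<le> card (G a)"
      using card_inj_on_le[OF _ _ finG] by blast
    then have "real (card (reps K)) * real (card ?A) \<le> real (card (G a))"
      by (simp add: card_cartesian_product flip: of_nat_mult)
    moreover have "real (card (reps K)) * M \<le> real (card (reps K)) * real (card ?A)"
      by (intro mult_left_mono M single) auto
    ultimately show ?thesis by (simp add: G_def)
  next
    case pair
    let ?a = "a(i := a i - a j)"
    have "sum ?a I < sum a I"
      using pair I by (intro sum_strict_mono_ex1) auto
    moreover have "\<exists>l\<in>I. \<not> p dvd ?a l" if "prime p" "p dvd c" for p
    proof (rule ccontr)
      assume "\<not> ?thesis"
      then have *: "\<And>l. l \<in> I \<Longrightarrow> p dvd ?a l" by blast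
      have "p dvd a j" "p dvd a i - a j" using *[of j] *[of i] pair by auto
      then have "p dvd a i" using pair by (metis dvd_diffD1 dvd_diffD)
      then have "\<forall>l\<in>I. p dvd a l" using * by (metis fun_upd_other)
      then show False using less.prems that by blast
    qed
    ultimately have IH: "real (card (reps K)) * M \<le> real (card (G ?a))"
      unfolding G_def by (rule less.hyps)
    \<comment> \<open>Undoes the subtraction of entry \<open>j\<close> from entry \<open>i\<close>
      on the \<open>K\<close>-parts; \<open>rho\<close> returns the sum to the transversal at the
      cost of an element of \<open>H\<close>. Entry \<open>j\<close> is kept, so entry
      \<open>i\<close> can be recovered and the map is injective.\<close>
    let ?T = "\<lambda>r. r(i := rho (r i + r j))"
    have "?T ` G ?a \<subseteq> G a"
    proof (rule image_subsetI)
      fix r assume r: "r \<in> G ?a"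
      have rP: "r \<in> PiE I (\<lambda>_. reps K)" and rg: "gen I (\<lambda>i. r i + real (?a i) *\<^sub>R b) = ?K'"
        using r by (auto simp: G_def)
      have mem: "r l \<in> K" if "l \<in> I" for l using rP that reps_subset by auto
      have "rho (r i + r j) \<in> reps K"
        using pair K mem by (intro rho_in_reps add_subgroup_add) auto
      then have TP: "?T r \<in> PiE I (\<lambda>_. reps K)" using rP pair by (auto simp: PiE_iff extensional_def)
      define y where "y = (\<lambda>l. ?T r l + real (a l) *\<^sub>R b)"
      define z where "z = (\<lambda>l. r l + real (?a l) *\<^sub>R b)"
      have yl: "y l = z l" if "l \<noteq> i" for l using that by (simp add: y_def z_def)
      have yi: "y i - (z i + z j) \<in> H"
      proof -
        have "y i - (z i + z j) = - ((r i + r j) - rho (r i + r j))"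
          using pair by (simp add: y_def z_def of_nat_diff algebra_simps)
        then show ?thesis using add_subgroup_minus[OF H diff_rho] by metis
      qed
      have "gen I y = gen I z"
      proof (rule gen_eqI)
        fix l assume l: "l \<in> I"
        show "y l \<in> gen I z"
        proof (cases "l = i")
          case True
          then show ?thesis
            using mem_iff_of_diff[OF subgroup_gen H_subset_gen yi, of I z]
              add_subgroup_add[OF subgroup_gen gen_mem[OF pair(1), of z] gen_mem[OF pair(2), of z]] by blast
        next
          case False
          then show ?thesis using yl[OF False] gen_mem[OF l, of z] by simp
        qed
        show "z l \<in> gen I y"
        proof (cases "l = i")
          case True
          have "z i + z j \<in> gen I y"
            using mem_iff_of_diff[OF subgroup_gen H_subset_gen yi, of I y] gen_mem[OF pair(1), of y] by blast
          moreover have "z j \<in> gen I y" using gen_mem[OF pair(2), of y] yl[of j] pair(3) by simp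
          ultimately have "(z i + z j) - z j \<in> gen I y"
            by (intro add_subgroup_diff) auto
          then show ?thesis using True by simp
        next
          case False
          then show ?thesis using yl[OF False] gen_mem[OF l, of y] by simp
        qed
      qed
      then show "?T r \<in> G a" using TP rg unfolding G_def y_def z_def by blast
    qed
    moreover have "inj_on ?T (G ?a)"
    proof (rule inj_onI)
      fix r s assume r: "r \<in> G ?a" "s \<in> G ?a" and eq: "?T r = ?T s"
      have ot: "r l = s l" if "l \<noteq> i" for l using fun_cong[OF eq, of l] that by simp
      have "rho (r i + r j) = rho (s i + s j)" using fun_cong[OF eq, of i] by simp
      then have "r i - s i \<in> H" using ot[of j] pair by (simp add: rho_eq_iff)
      moreover have "r i \<in> reps K" "s i \<in> reps K" using r pair by (auto simp: G_def)
      ultimately have "r i = s i" by (intro reps_eqI)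
      then show "r = s" using ot by (intro ext) metis
    qed
    ultimately have "card (G ?a) \<le> card (G a)"
      using card_inj_on_le[OF _ _ finG] by blast
    then show ?thesis using IH by (simp add: G_def)
  qed
qed

text \<open>\<open>K j\<close> is generated over \<open>H\<close> by the first \<open>j\<close>
  elements of \<open>b\<close>. The induction step removes one generator and one tuple entry
  simultaneously, so the lower end \<open>card I - j + 1\<close> of the product stays fixed and only
  the top factor \<open>1 / zeta_real (card I)\<close> is split off. The hypothesis
  \<open>card I >= j + 1\<close> keeps all zeta arguments at least 2.\<close>

lemma card_generating_tuples_ge:
  fixes b :: "nat \<Rightarrow> 'a"
  defines "K \<equiv> (\<lambda>j. gen {..<j} b)"
  assumes "finite (reps (K j))" "finite I" "card I \<ge> j + 1"
  shows "real (card (reps (K j))) ^ card I * (\<Prod>i = card I - j + 1..card I. 1 / zeta_real (real i))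
    \<le> real (card {y \<in> PiE I (\<lambda>_. reps (K j)). gen I y = K j})"
  using assms(2-)
proof (induction j arbitrary: I)
  case 0
  have K0: "K 0 = H"
    using add_subgroup_generated_minimal[of H H] H subset_add_subgroup_generated[of H]
    by (auto simp: K_def gen_def)
  have reps: "reps (K 0) = {rho 0}"
    using rho_in_reps[OF H subset_refl add_subgroup_0[OF H]] reps_eqI[of _ H "rho 0"]
      add_subgroup_diff[OF H] reps_subset[of H]
    unfolding K0 by blast
  have "gen I y = K 0" if "y \<in> PiE I (\<lambda>_. {rho 0})" for y
  proof (rule subset_antisym)
    show "gen I y \<subseteq> K 0"
      using that reps reps_subset[of "K 0"] H by (subst gen_subset_iff) (auto simp: K0)
    show "K 0 \<subseteq> gen I y" unfolding K0 by (rule H_subset_gen)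
  qed
  then have "{y \<in> PiE I (\<lambda>_. reps (K 0)). gen I y = K 0} = PiE I (\<lambda>_. {rho 0})"
    unfolding reps by blast
  moreover have "card (PiE I (\<lambda>_. {rho 0})) = 1"
    using 0 by (simp add: card_PiE)
  ultimately show ?case by (simp add: reps)
next
  case (Suc j I)
  let ?b = "b j" and ?R = "reps (K j)" and ?R' = "reps (K (Suc j))"
  have Kj: "add_subgroup (K j)" "H \<subseteq> K j" and KSj: "add_subgroup (K (Suc j))" "H \<subseteq> K (Suc j)"
    by (auto simp: K_def H_subset_gen[THEN subsetD])
  have Kb: "b i \<in> K l" if "i < l" for i l
    using gen_mem[of i "{..<l}" b] that by (simp add: K_def)
  have Kmono: "K j \<subseteq> K (Suc j)"
    using Kb KSj by (simp add: K_def gen_subset_iff)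
  have KSuc: "K (Suc j) = add_subgroup_generated (insert ?b (K j))"
  proof (rule subset_antisym)
    have *: "insert ?b (K j) \<subseteq> add_subgroup_generated (insert ?b (K j))"
      by (rule subset_add_subgroup_generated)
    have "b i \<in> insert ?b (K j)" if "i < Suc j" for i
      using that Kb[of i j] by (cases "i = j") auto
    then have "b i \<in> add_subgroup_generated (insert ?b (K j))" if "i < Suc j" for i
      using that * by blast
    then show "K (Suc j) \<subseteq> add_subgroup_generated (insert ?b (K j))"
      using * Kj unfolding K_def by (subst gen_subset_iff) auto
    show "add_subgroup_generated (insert ?b (K j)) \<subseteq> K (Suc j)"
      using Kmono Kb[of j "Suc j"] KSj by (intro add_subgroup_generated_minimal) auto
  qed
  have fin: "finite ?R"
    using Suc.prems(1) Kmono by (auto simp: reps_def intro: rev_finite_subset)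
  \<comment> \<open>Pigeonhole: the multiples of \<open>?b\<close> lie in finitely many classes, so
    two of them agree modulo \<open>H\<close>. The least such \<open>c\<close>, chosen next, is the
    order of \<open>?b\<close> modulo \<open>K j\<close>.\<close>
  have "\<exists>c. 0 < c \<and> real c *\<^sub>R ?b \<in> K j"
  proof -
    have "rho (real m *\<^sub>R ?b) \<in> ?R'" for m
      using KSj Kb[of j "Suc j"] by (intro rho_in_reps add_subgroup_scaleR_nat) auto
    then have "\<not> inj (\<lambda>m. rho (real m *\<^sub>R ?b))"
      using Suc.prems(1) by (metis finite_subset finite_imageD image_subsetI infinite_UNIV_nat)
    then obtain m m' where "rho (real m *\<^sub>R ?b) = rho (real m' *\<^sub>R ?b)" "m < m'"
      unfolding inj_def by (metis linorder_neqE_nat)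
    then have "real (m' - m) *\<^sub>R ?b \<in> H"
      using rho_eq_iff[of "real m' *\<^sub>R ?b" "real m *\<^sub>R ?b"]
      by (simp add: of_nat_diff algebra_simps)
    then show ?thesis using \<open>m < m'\<close> Kj by (intro exI[of _ "m' - m"]) auto
  qed
  then obtain c where c: "0 < c" "real c *\<^sub>R ?b \<in> K j"
    and cmin: "\<And>m. 0 < m \<Longrightarrow> m < c \<Longrightarrow> real m *\<^sub>R ?b \<notin> K j"
    using exists_least_iff[of "\<lambda>c. 0 < c \<and> real c *\<^sub>R ?b \<in> K j"] by auto
  \<comment> \<open>Each class of \<open>K (Suc j)\<close> modulo \<open>H\<close> is
    \<open>r + m *\<^sub>R ?b\<close> for a unique \<open>r\<close> in the transversal of
    \<open>K j\<close> and a unique \<open>m < c\<close>. Uniqueness of \<open>m\<close> is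
    minimality of \<open>c\<close>; for existence a multiple of \<open>c *\<^sub>R ?b\<close> is
    absorbed into the \<open>K j\<close> part.\<close>
  define phi where "phi = (\<lambda>(r, m::nat). rho (r + real m *\<^sub>R ?b))"
  have phi_mem: "phi (r, m) \<in> ?R'" if "r \<in> ?R" for r m
  proof -
    have "r \<in> K (Suc j)" using that reps_subset Kmono by blast
    then show ?thesis unfolding phi_def split
      using KSj Kb[of j "Suc j"] by (intro rho_in_reps add_subgroup_add add_subgroup_scaleR_nat) auto
  qed
  have phi_inj: "r = r' \<and> m = m'"
    if eq: "phi (r, m) = phi (r', m')" and mem: "r \<in> ?R" "r' \<in> ?R" "m < c" "m' < c" for r r' m m'
  proof -
    have "m = m'" if le: "m \<le> m'" and eq: "phi (r', m') = phi (r, m)" and mem: "r \<in> ?R" "r' \<in> ?R" "m' < c"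
      for r r' m m'
    proof (rule ccontr)
      assume "m \<noteq> m'"
      have "(r' + real m' *\<^sub>R ?b) - (r + real m *\<^sub>R ?b) \<in> K j"
        using eq Kj by (auto simp: phi_def rho_eq_iff)
      moreover have "r - r' \<in> K j" using mem reps_subset[of "K j"] by (intro add_subgroup_diff Kj) auto
      ultimately have "(r' + real m' *\<^sub>R ?b) - (r + real m *\<^sub>R ?b) + (r - r') \<in> K j"
        by (intro add_subgroup_add Kj)
      then have "real (m' - m) *\<^sub>R ?b \<in> K j"
        using le by (simp add: of_nat_diff algebra_simps)
      moreover have "0 < m' - m" "m' - m < c" using mem le \<open>m \<noteq> m'\<close> by auto
      ultimately show False using cmin by blast
    qed
    then have "m = m'" using eq mem by (metis nle_le)
    moreover from this have "r - r' \<in> H" using eq by (simp add: phi_def rho_eq_iff)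
    ultimately show ?thesis using reps_eqI mem by blast
  qed
  have phi_bij: "bij_betw phi (?R \<times> {..<c}) ?R'"
  proof (rule bij_betwI')
    show "phi x = phi y \<longleftrightarrow> x = y" if "x \<in> ?R \<times> {..<c}" "y \<in> ?R \<times> {..<c}" for x y
      using phi_inj[of "fst x" "snd x" "fst y" "snd y"] that
      by (cases x, cases y) auto
    show "phi x \<in> ?R'" if "x \<in> ?R \<times> {..<c}" for x
      using phi_mem[of "fst x" "snd x"] that by (simp add: mem_Times_iff)
    fix y assume y: "y \<in> ?R'"
    then have "y \<in> K (Suc j)" using reps_subset by blast
    then obtain x z where xz: "y = x + of_int z *\<^sub>R ?b" "x \<in> K j"
      unfolding KSuc add_subgroup_generated_insert[OF Kj(1)] by blast
    define m where "m = nat (z mod int c)"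
    have m: "m < c" "z = z div int c * int c + int m"
      using c by (auto simp: m_def nat_less_iff)
    define x' where "x' = x + of_int (z div int c) *\<^sub>R (real c *\<^sub>R ?b)"
    have x': "x' \<in> K j" unfolding x'_def
      using xz c Kj by (intro add_subgroup_add add_subgroup_scaleR_int)
    have y': "y = x' + real m *\<^sub>R ?b"
    proof -
      have "of_int z *\<^sub>R ?b = of_int (z div int c * int c + int m) *\<^sub>R ?b" using m(2) by simp
      then show ?thesis by (simp add: xz(1) x'_def scaleR_add_left)
    qed
    have "rho x' \<in> ?R" using x' Kj by (intro rho_in_reps)
    moreover have "y = phi (rho x', m)"
    proof -
      have "y = rho y" using y by (simp add: reps_def)
      also have "\<dots> = rho (rho x' + real m *\<^sub>R ?b)"
        by (rule rho_eqI) (simp add: y' diff_rho)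
      finally show ?thesis by (simp add: phi_def)
    qed
    ultimately show "\<exists>x\<in>?R \<times> {..<c}. y = phi x" using m by blast
  qed
  then have cardR': "card ?R' = card ?R * c"
    by (metis bij_betw_same_card card_cartesian_product card_lessThan)

  define k where "k = card I"
  have k: "k \<ge> j + 2" using Suc.prems by (simp add: k_def)
  have I: "I \<noteq> {}" using Suc.prems by auto
  \<comment> \<open>Via \<open>phi\<close> a tuple in \<open>K (Suc j)\<close> splits into a
    coefficient tuple \<open>a\<close> and a tuple \<open>r\<close> in \<open>K j\<close>. The
    generating tuples are counted fibrewise: only those \<open>a\<close> jointly coprime to
    \<open>c\<close> are used, and for each of them the tuples \<open>r\<close> in
    \<open>Good a\<close>.\<close>
  define Cop where "Cop = {a \<in> PiE I (\<lambda>_. {..<c}). \<forall>p. prime p \<longrightarrow> p dvd c \<longrightarrow> (\<exists>i\<in>I. \<not> p dvd a i)}"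
  define Good where "Good = (\<lambda>a. {r \<in> PiE I (\<lambda>_. ?R). gen I (\<lambda>i. r i + real (a i) *\<^sub>R ?b) = K (Suc j)})"
  let ?G = "{y \<in> PiE I (\<lambda>_. ?R'). gen I y = K (Suc j)}"
  \<comment> \<open>The induction hypothesis for \<open>k - 1\<close> entries: the number guaranteed
    for tuples generating \<open>K j\<close> after one entry has been used up by
    \<open>?b\<close>.\<close>
  define M where "M = real (card ?R) ^ (k - 1) * (\<Prod>i = k - j..k - 1. 1 / zeta_real (real i))"
  have M: "M \<le> real (card {r \<in> PiE (I - {i}) (\<lambda>_. ?R). gen (I - {i}) r = K j})" if "i \<in> I" for i
  proof -
    have "card (I - {i}) = k - 1" using that by (simp add: k_def)
    moreover have "k - 1 - j + 1 = k - j" using k by simp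
    ultimately show ?thesis
      using Suc.IH[of "I - {i}"] fin Suc.prems k unfolding M_def by simp
  qed
  have good: "real (card ?R) * M \<le> real (card (Good a))" if "a \<in> Cop" for a
    unfolding Good_def KSuc
    by (rule card_generating_translate_ge[OF Suc.prems(2) I Kj fin c(2,1)])
       (use that M in \<open>auto simp: Cop_def\<close>)
  have finGood: "finite (Good a)" for a
  proof -
    have "finite (PiE I (\<lambda>_. ?R))" using Suc.prems fin by (intro finite_PiE)
    then show ?thesis unfolding Good_def by (rule rev_finite_subset) blast
  qed
  have finCop: "finite Cop"
  proof -
    have "finite (PiE I (\<lambda>_. {..<c}))" using Suc.prems by (intro finite_PiE) auto
    then show ?thesis unfolding Cop_def by (rule rev_finite_subset) blast
  qed
  have finG: "finite ?G"
  proof -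
    have "finite (PiE I (\<lambda>_. ?R'))" using Suc.prems by (intro finite_PiE) auto
    then show ?thesis by (rule rev_finite_subset) blast
  qed
  define Psi where "Psi = (\<lambda>(a, r). \<lambda>i\<in>I. phi (r i, a i :: nat))"
  have "Psi ` Sigma Cop Good \<subseteq> ?G"
  proof (rule image_subsetI)
    fix u assume "u \<in> Sigma Cop Good"
    then obtain a r where u: "u = (a, r)" "a \<in> Cop" "r \<in> Good a" by blast
    have r: "r i \<in> ?R" if "i \<in> I" for i using u(3) that by (auto simp: Good_def)
    have "gen I (Psi u) = gen I (\<lambda>i. r i + real (a i) *\<^sub>R ?b)"
    proof (rule gen_cong)
      fix i assume "i \<in> I"
      then have "Psi u i = rho (r i + real (a i) *\<^sub>R ?b)" by (simp add: Psi_def u phi_def)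
      then show "Psi u i - (r i + real (a i) *\<^sub>R ?b) \<in> H"
        using add_subgroup_minus[OF H diff_rho] by (metis minus_diff_eq)
    qed
    then show "Psi u \<in> ?G"
      using u r phi_mem by (auto simp: Good_def Psi_def)
  qed
  moreover have "inj_on Psi (Sigma Cop Good)"
  proof (rule inj_onI)
    fix u w assume uw: "u \<in> Sigma Cop Good" "w \<in> Sigma Cop Good" "Psi u = Psi w"
    obtain a r a' r' where e: "u = (a, r)" "w = (a', r')" by (cases u, cases w)
    have ext: "a \<in> PiE I (\<lambda>_. {..<c})" "a' \<in> PiE I (\<lambda>_. {..<c})" "r \<in> PiE I (\<lambda>_. ?R)" "r' \<in> PiE I (\<lambda>_. ?R)"
      using uw e by (auto simp: Cop_def Good_def)
    have "r i = r' i \<and> a i = a' i" if "i \<in> I" for i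
    proof (rule phi_inj)
      show "phi (r i, a i) = phi (r' i, a' i)"
        using fun_cong[OF uw(3), of i] that by (simp add: Psi_def e)
    qed (use ext that in auto)
    then have "r = r'" "a = a'"
      using PiE_ext[OF ext(3,4)] PiE_ext[OF ext(1,2)] by auto
    then show "u = w" by (simp add: e)
  qed
  ultimately have "card (Sigma Cop Good) \<le> card ?G"
    by (intro card_inj_on_le[OF _ _ finG])
  then have "(\<Sum>a\<in>Cop. real (card (Good a))) \<le> real (card ?G)"
    using finCop finGood by (simp flip: of_nat_sum)
  moreover have "real (card Cop) * (real (card ?R) * M) \<le> (\<Sum>a\<in>Cop. real (card (Good a)))"
    using sum_mono[of Cop "\<lambda>_. real (card ?R) * M", OF good] by simp
  ultimately have le: "real (card Cop) * (real (card ?R) * M) \<le> real (card ?G)"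
    by linarith
  have "0 \<le> M"
    unfolding M_def using k zeta_real_ge_1
    by (intro mult_nonneg_nonneg prod_nonneg) (auto intro!: order_trans[OF zero_le_one])
  then have "real c ^ k / zeta_real (real k) * (real (card ?R) * M) \<le> real (card Cop) * (real (card ?R) * M)"
    using card_coprime_tuples_ge[of I c] Suc.prems c k
    by (intro mult_right_mono) (auto simp: Cop_def k_def)
  also note le
  finally have fin_le: "real c ^ k / zeta_real (real k) * (real (card ?R) * M) \<le> real (card ?G)" .
  have k': "k = Suc (k - 1)" "k - j \<le> Suc (k - 1)" "k - Suc j + 1 = k - j" using k by auto
  have "(\<Prod>i = k - j..k. 1 / zeta_real (real i))
      = (\<Prod>i = k - j..k - 1. 1 / zeta_real (real i)) * (1 / zeta_real (real k))"
    using prod.nat_ivl_Suc'[of "k - j" "k - 1" "\<lambda>i. 1 / zeta_real (real i)"] k' by simp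
  moreover have "real (card ?R) ^ k = real (card ?R) * real (card ?R) ^ (k - 1)"
    by (subst k'(1)) (rule power_Suc)
  ultimately have "real (card ?R') ^ k * (\<Prod>i = k - j..k. 1 / zeta_real (real i))
     = real c ^ k / zeta_real (real k) * (real (card ?R) * M)"
    by (simp add: cardR' M_def power_mult_distrib)
  then show ?case using fin_le unfolding k_def[symmetric] k'(3) by simp
qed

end

section \<open>Counting lattice points with Voronoi cells\<close>

lemma full_rank_lattice_subgroup: "full_rank_lattice L \<Longrightarrow> add_subgroup L"
  by (auto simp: full_rank_lattice_def add_subgroup_def)

lemma full_rank_lattice_span: "full_rank_lattice L \<Longrightarrow> span L = UNIV"
  by (simp add: full_rank_lattice_def)

lemma full_rank_lattice_uniform_discrete:
  assumes "full_rank_lattice L"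
  shows "uniform_discrete L"
proof -
  obtain e where e: "e > 0" "\<And>x. x \<in> L \<Longrightarrow> x \<noteq> 0 \<Longrightarrow> e \<le> norm x"
    using assms by (auto simp: full_rank_lattice_def)
  show ?thesis
  proof (rule uniformI1[OF e(1)])
    fix x y assume xy: "x \<in> L" "y \<in> L" "dist x y < e"
    then have "x - y \<in> L"
      using add_subgroup_diff full_rank_lattice_subgroup assms by blast
    then show "x = y" using e(2)[of "x - y"] xy by (auto simp: dist_norm)
  qed
qed

lemma full_rank_lattice_closed: "full_rank_lattice L \<Longrightarrow> closed L"
  using full_rank_lattice_uniform_discrete uniform_discrete_imp_closed by blast

lemma full_rank_lattice_finite_Int:
  assumes "full_rank_lattice L" "bounded S"
  shows "finite (L \<inter> S)"
proof -
  have "uniform_discrete (L \<inter> S)"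
    using full_rank_lattice_uniform_discrete[OF assms(1)] by (rule uniform_discrete_subset) blast
  moreover have "bounded (L \<inter> S)" using assms(2) by (rule bounded_subset) blast
  ultimately show ?thesis using uniform_discrete_finite_iff by blast
qed

lemma covering_radius_eq_infdist:
  assumes "L \<noteq> {}"
  shows "covering_radius L = (SUP x. infdist x L)"
  using assms by (simp add: covering_radius_def infdist_def dist_norm)

text \<open>Ensures that the supremum in \<open>covering_radius\<close> is a genuine one. Rounding
  down the coordinates with respect to a basis of lattice vectors gives a lattice point at distance
  at most the sum of the basis norms.\<close>

lemma full_rank_lattice_infdist_bounded:
  assumes L: "full_rank_lattice L"
  shows "bdd_above (range (\<lambda>x. infdist x L))"
proof -
  obtain B where B: "B \<subseteq> L" "independent B" "span B = UNIV"
    using maximal_independent_subset[of L] full_rank_lattice_span[OF L]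
    by (metis span_mono span_span top.extremum_uniqueI)
  have finB: "finite B" using B(2) by (rule independent_imp_finite)
  have "infdist x L \<le> (\<Sum>b\<in>B. norm b)" for x
  proof -
    have "x \<in> span B" using B by simp
    then obtain u where u: "x = (\<Sum>b\<in>B. u b *\<^sub>R b)" using finB by (auto simp: span_finite)
    define y where "y = (\<Sum>b\<in>B. of_int \<lfloor>u b\<rfloor> *\<^sub>R b)"
    have "y \<in> L" unfolding y_def
      using B full_rank_lattice_subgroup[OF L] by (intro add_subgroup_sum add_subgroup_scaleR_int) auto
    then have "infdist x L \<le> norm (x - y)" by (metis infdist_le dist_norm)
    also have "x - y = (\<Sum>b\<in>B. frac (u b) *\<^sub>R b)"
      by (simp add: u y_def frac_def algebra_simps flip: sum_subtractf)
    also have "norm \<dots> \<le> (\<Sum>b\<in>B. norm (frac (u b) *\<^sub>R b))" by (rule norm_sum)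
    also have "\<dots> \<le> (\<Sum>b\<in>B. norm b)"
      by (intro sum_mono) (simp add: mult_left_le_one_le frac_lt_1 less_imp_le)
    finally show ?thesis .
  qed
  then show ?thesis by (intro bdd_aboveI) auto
qed

lemma infdist_le_covering_radius:
  assumes L: "full_rank_lattice L"
  shows "infdist x L \<le> covering_radius L"
proof -
  have "L \<noteq> {}" using L by (auto simp: full_rank_lattice_def)
  then show ?thesis
    unfolding covering_radius_eq_infdist[OF \<open>L \<noteq> {}\<close>]
    by (intro cSUP_upper full_rank_lattice_infdist_bounded[OF L]) auto
qed

text \<open>A vector of half the minimal length \<open>e\<close> is not in \<open>L\<close>, and
  since \<open>L\<close> is closed it has positive distance from it.\<close>

lemma covering_radius_pos:
  fixes L :: "'a::euclidean_space set"
  assumes L: "full_rank_lattice L"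
  shows "covering_radius L > 0"
proof -
  obtain e where e: "e > 0" "\<And>x. x \<in> L \<Longrightarrow> x \<noteq> 0 \<Longrightarrow> e \<le> norm x"
    using L by (auto simp: full_rank_lattice_def)
  obtain b :: 'a where b: "b \<in> Basis" by (meson nonempty_Basis ex_in_conv)
  let ?x = "(e / 2) *\<^sub>R b"
  have n: "norm ?x = e / 2" using b e by simp
  then have "?x \<notin> L" using e by (metis norm_eq_zero half_gt_zero_iff less_irrefl not_le field_sum_of_halves less_add_same_cancel1)
  moreover have "L \<noteq> {}" using L by (auto simp: full_rank_lattice_def)
  ultimately have "infdist ?x L \<noteq> 0"
    using in_closed_iff_infdist_zero[OF full_rank_lattice_closed[OF L]] by blast
  then have "infdist ?x L > 0" using infdist_nonneg[of ?x L] by simp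
  then show ?thesis using infdist_le_covering_radius[OF L, of ?x] by simp
qed

text \<open>Taken closed, which makes it compact and measurable; translates by distinct lattice
  vectors then overlap, but only in null sets. Its measure serves as the covolume of
  \<open>L\<close>.\<close>

definition voronoi_cell :: "'a::real_normed_vector set \<Rightarrow> 'a set" where
  "voronoi_cell L = {x. \<forall>l\<in>L. norm x \<le> norm (x - l)}"

text \<open>Closedness of \<open>L\<close> makes the distance attained. A nearest point
  \<open>l\<close> puts \<open>x\<close> into the cell around \<open>l\<close>, so the cells cover
  space.\<close>

lemma nearest_lattice_point:
  assumes L: "full_rank_lattice L"
  obtains l where "l \<in> L" "x - l \<in> voronoi_cell L" "norm (x - l) \<le> covering_radius L"
proof -
  have "L \<noteq> {}" using L by (auto simp: full_rank_lattice_def)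
  then obtain l where l: "l \<in> L" "infdist x L = dist x l"
    using infdist_attains_inf[OF full_rank_lattice_closed[OF L]] by blast
  have "x - l \<in> voronoi_cell L" unfolding voronoi_cell_def
  proof (intro CollectI ballI)
    fix m assume "m \<in> L"
    then have "l + m \<in> L" using l add_subgroup_add[OF full_rank_lattice_subgroup[OF L]] by blast
    then have "infdist x L \<le> dist x (l + m)" by (rule infdist_le)
    then show "norm (x - l) \<le> norm (x - l - m)"
      unfolding l(2) by (simp add: dist_norm algebra_simps)
  qed
  moreover have "norm (x - l) \<le> covering_radius L"
    using infdist_le_covering_radius[OF L, of x] l by (simp add: dist_norm)
  ultimately show ?thesis using that l by blast
qed

lemma norm_voronoi_cell_le:
  assumes L: "full_rank_lattice L" and x: "x \<in> voronoi_cell L"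
  shows "norm x \<le> covering_radius L"
proof -
  obtain l where "l \<in> L" "norm (x - l) \<le> covering_radius L"
    using nearest_lattice_point[OF L, of x] by blast
  then show ?thesis using x unfolding voronoi_cell_def by force
qed

lemma compact_voronoi_cell:
  fixes L :: "'a::euclidean_space set"
  assumes L: "full_rank_lattice L"
  shows "compact (voronoi_cell L)"
proof -
  have "closed (\<Inter>l\<in>L. {x. norm x \<le> norm (x - l)})"
    by (intro closed_INT ballI closed_Collect_le continuous_intros)
  moreover have "voronoi_cell L = (\<Inter>l\<in>L. {x. norm x \<le> norm (x - l)})"
    by (auto simp: voronoi_cell_def)
  moreover have "bounded (voronoi_cell L)"
    using norm_voronoi_cell_le[OF L] by (auto simp: bounded_iff)
  ultimately show ?thesis by (simp add: compact_eq_bounded_closed)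
qed

lemma negligible_equidistant:
  fixes a b :: "'a::euclidean_space"
  assumes "a \<noteq> b"
  shows "negligible {x. norm (x - a) = norm (x - b)}"
proof -
  have "{x. norm (x - a) = norm (x - b)} = {x. (2 *\<^sub>R (b - a)) \<bullet> x = b \<bullet> b - a \<bullet> a}"
    by (auto simp: norm_eq algebra_simps inner_commute)
  moreover have "negligible {x. (2 *\<^sub>R (b - a)) \<bullet> x = b \<bullet> b - a \<bullet> a}"
    using assms by (intro negligible_hyperplane) auto
  ultimately show ?thesis by simp
qed

text \<open>A point common to the cells around \<open>l\<close> and \<open>m\<close> is equidistant
  from both, hence lies in the bisecting hyperplane, which is negligible. Measures of the translates
  therefore add up.\<close>

lemma measure_voronoi_translates:
  fixes L F :: "'a::euclidean_space set"
  assumes L: "full_rank_lattice L" and F: "F \<subseteq> L" "finite F"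
  shows "measure lebesgue (\<Union>l\<in>F. (+) l ` voronoi_cell L) = real (card F) * measure lebesgue (voronoi_cell L)"
proof -
  have meas: "(+) l ` voronoi_cell L \<in> lmeasurable" for l
    by (intro measurable_translation lmeasurable_compact compact_voronoi_cell L)
  have "measure lebesgue (\<Union>l\<in>F. (+) l ` voronoi_cell L) = (\<Sum>l\<in>F. measure lebesgue ((+) l ` voronoi_cell L))"
  proof (rule measure_negligible_finite_Union_image[OF F(2) meas])
    show "pairwise (\<lambda>l m. negligible ((+) l ` voronoi_cell L \<inter> (+) m ` voronoi_cell L)) F"
    proof (rule pairwiseI)
      fix l m assume lm: "l \<in> F" "m \<in> F" "l \<noteq> m"
      have le: "norm (x - l) \<le> norm (x - m)" if x: "x \<in> (+) l ` voronoi_cell L" "l \<in> F" "m \<in> F" for x l m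
      proof -
        have "m - l \<in> L" using F x(2,3) add_subgroup_diff[OF full_rank_lattice_subgroup[OF L]] by blast
        moreover obtain c where "c \<in> voronoi_cell L" "x = l + c" using x(1) by blast
        ultimately have "norm c \<le> norm (c - (m - l))" unfolding voronoi_cell_def by blast
        then show ?thesis by (simp add: \<open>x = l + c\<close> algebra_simps)
      qed
      have "(+) l ` voronoi_cell L \<inter> (+) m ` voronoi_cell L \<subseteq> {x. norm (x - l) = norm (x - m)}"
      proof (rule subsetI, rule CollectI)
        fix x assume "x \<in> (+) l ` voronoi_cell L \<inter> (+) m ` voronoi_cell L"
        then show "norm (x - l) = norm (x - m)"
          using le[of x l m] le[of x m l] lm(1,2) by (simp only: Int_iff order_antisym)
      qed
      then show "negligible ((+) l ` voronoi_cell L \<inter> (+) m ` voronoi_cell L)"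
        by (rule negligible_subset[OF negligible_equidistant[OF lm(3)]])
    qed
  qed
  also have "\<dots> = real (card F) * measure lebesgue (voronoi_cell L)"
    by (simp add: measure_translation)
  finally show ?thesis .
qed

text \<open>Packing half of the volume comparison: the almost disjoint cells around the points of
  \<open>F\<close> fit into \<open>W\<close>.\<close>

lemma card_lattice_times_covolume_le:
  fixes L F :: "'a::euclidean_space set"
  assumes L: "full_rank_lattice L" and F: "F \<subseteq> L" "finite F" and W: "W \<in> lmeasurable"
    and sub: "\<And>l c. l \<in> F \<Longrightarrow> norm c \<le> covering_radius L \<Longrightarrow> l + c \<in> W"
  shows "real (card F) * measure lebesgue (voronoi_cell L) \<le> measure lebesgue W"
proof -
  have "(\<Union>l\<in>F. (+) l ` voronoi_cell L) \<subseteq> W"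
    using sub norm_voronoi_cell_le[OF L] by blast
  moreover have "(\<Union>l\<in>F. (+) l ` voronoi_cell L) \<in> sets lebesgue"
    by (intro sets.finite_UN F(2) fmeasurableD measurable_translation lmeasurable_compact compact_voronoi_cell L)
  ultimately show ?thesis
    unfolding measure_voronoi_translates[OF L F, symmetric] using W
    by (intro measure_mono_fmeasurable) auto
qed

text \<open>Covering half: a nearest lattice point of any point of \<open>W\<close> belongs to
  \<open>F\<close>, so the cells around \<open>F\<close> cover \<open>W\<close>.\<close>

lemma card_lattice_times_covolume_ge:
  fixes L F :: "'a::euclidean_space set"
  assumes L: "full_rank_lattice L" and F: "F \<subseteq> L" "finite F" and W: "W \<in> lmeasurable"
    and sub: "\<And>l x. x \<in> W \<Longrightarrow> l \<in> L \<Longrightarrow> norm (x - l) \<le> covering_radius L \<Longrightarrow> l \<in> F"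
  shows "measure lebesgue W \<le> real (card F) * measure lebesgue (voronoi_cell L)"
proof -
  have "W \<subseteq> (\<Union>l\<in>F. (+) l ` voronoi_cell L)"
  proof
    fix x assume "x \<in> W"
    then obtain l where "l \<in> F" "x - l \<in> voronoi_cell L"
      using nearest_lattice_point[OF L, of x] sub by metis
    moreover have "x = l + (x - l)" by simp
    ultimately show "x \<in> (\<Union>l\<in>F. (+) l ` voronoi_cell L)" by blast
  qed
  moreover have "(\<Union>l\<in>F. (+) l ` voronoi_cell L) \<in> lmeasurable"
    by (intro fmeasurable.finite_UN F(2) measurable_translation lmeasurable_compact compact_voronoi_cell L)
  ultimately show ?thesis
    unfolding measure_voronoi_translates[OF L F, symmetric] using W
    by (intro measure_mono_fmeasurable) auto
qed

section \<open>Lattice points in cubes\<close>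

definition cube :: "real \<Rightarrow> real \<Rightarrow> (real ^ 'n) set" where
  "cube a s = {x. \<forall>i. a \<le> x $ i \<and> x $ i < a + s}"

lemma box0_eq_cube: "box0 B = cube 0 B"
  by (simp add: box0_def cube_def)

lemma bounded_cube: "bounded (cube a s)"
proof -
  have "cube a s \<subseteq> cbox (\<chi> i. a) (\<chi> i. a + s)"
    by (auto simp: cube_def mem_box_cart less_imp_le)
  then show ?thesis using bounded_cbox bounded_subset by blast
qed

lemma measure_cbox_const:
  assumes "0 \<le> s"
  shows "measure lebesgue (cbox (\<chi> i. a) (\<chi> i. a + s) :: (real ^ 'n) set) = s ^ CARD('n)"
proof -
  have "cbox (\<chi> i. a) (\<chi> i. a + s :: real ^ 'n) \<noteq> {}"
    using assms by (subst interval_ne_empty_cart(1)) simp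
  then have "measure lborel (cbox (\<chi> i. a) (\<chi> i. a + s :: real ^ 'n)) = s ^ CARD('n)"
    by (subst content_cbox_cart) simp_all
  then show ?thesis by (simp only: measure_completion lmeasurable_cbox sets_lborel borel_closed closed_cbox)
qed

lemma measure_box_const:
  assumes "0 \<le> s"
  shows "measure lebesgue (box (\<chi> i. a) (\<chi> i. a + s) :: (real ^ 'n) set) = s ^ CARD('n)"
proof -
  have "measure lebesgue (box (\<chi> i. a) (\<chi> i. a + s) :: (real ^ 'n) set)
      = measure lebesgue (cbox (\<chi> i. a) (\<chi> i. a + s) :: (real ^ 'n) set)"
    by (simp add: measure_lborel_box_eq measure_lborel_cbox_eq)
  then show ?thesis using measure_cbox_const[OF assms, of a] by simp
qed

text \<open>The cells around the counted points stay inside the cube widened by the covering radius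
  on every side.\<close>

lemma card_lattice_cube_le:
  fixes L :: "(real ^ 'n) set"
  assumes L: "full_rank_lattice L" and s: "0 \<le> s"
  shows "real (card (L \<inter> cube a s)) * measure lebesgue (voronoi_cell L)
           \<le> (s + 2 * covering_radius L) ^ CARD('n)"
proof -
  let ?r = "covering_radius L"
  let ?W = "cbox (\<chi> i. a - ?r) (\<chi> i. (a - ?r) + (s + 2 * ?r)) :: (real ^ 'n) set"
  have "real (card (L \<inter> cube a s)) * measure lebesgue (voronoi_cell L) \<le> measure lebesgue ?W"
  proof (rule card_lattice_times_covolume_le[OF L])
    fix l c :: "real ^ 'n" assume lc: "l \<in> L \<inter> cube a s" "norm c \<le> ?r"
    have "\<bar>c $ i\<bar> \<le> ?r" for i using component_le_norm_cart[of c i] lc by linarith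
    moreover have "a \<le> l $ i" "l $ i < a + s" for i using lc by (auto simp: cube_def)
    ultimately show "l + c \<in> ?W"
      unfolding mem_box_cart by (simp add: abs_le_iff) (smt (verit))
  qed (auto intro: full_rank_lattice_finite_Int[OF L bounded_cube])
  then show ?thesis
    using measure_cbox_const[where 'n = 'n, of "s + 2 * ?r" "a - ?r"] s covering_radius_pos[OF L] by simp
qed

lemma card_lattice_cube_ge:
  fixes L :: "(real ^ 'n) set"
  assumes L: "full_rank_lattice L" and s: "2 * covering_radius L \<le> s"
  shows "(s - 2 * covering_radius L) ^ CARD('n)
           \<le> real (card (L \<inter> cube a s)) * measure lebesgue (voronoi_cell L)"
proof -
  let ?r = "covering_radius L"
  \<comment> \<open>Shrinking by the covering radius on every side keeps nearest lattice points in
    the cube. The open box yields the strict upper inequality that the half-open cube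
    demands.\<close>
  let ?W = "box (\<chi> i. a + ?r) (\<chi> i. (a + ?r) + (s - 2 * ?r)) :: (real ^ 'n) set"
  have "measure lebesgue ?W \<le> real (card (L \<inter> cube a s)) * measure lebesgue (voronoi_cell L)"
  proof (rule card_lattice_times_covolume_ge[OF L])
    fix l x :: "real ^ 'n" assume lx: "x \<in> ?W" "l \<in> L" "norm (x - l) \<le> ?r"
    have c: "\<bar>x $ i - l $ i\<bar> \<le> ?r" for i using component_le_norm_cart[of "x - l" i] lx by simp
    have x: "a + ?r < x $ i" "x $ i < a + s - ?r" for i
      using lx(1) unfolding mem_box_cart by (auto simp: algebra_simps dest: spec[of _ i])
    have "a \<le> l $ i \<and> l $ i < a + s" for i
      using c[of i] x[of i] by linarith
    then show "l \<in> L \<inter> cube a s" using lx(2) by (simp add: cube_def)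
  qed (auto intro: full_rank_lattice_finite_Int[OF L bounded_cube])
  then show ?thesis
    using measure_box_const[where 'n = 'n, of "s - 2 * ?r" "a + ?r"] s by simp
qed

text \<open>The lower count for a cube of side four covering radii has a positive left-hand side,
  which a null cell would contradict.\<close>

lemma covolume_pos:
  fixes L :: "(real ^ 'n) set"
  assumes L: "full_rank_lattice L"
  shows "measure lebesgue (voronoi_cell L) > 0"
proof -
  have "0 < (4 * covering_radius L - 2 * covering_radius L) ^ CARD('n)"
    using covering_radius_pos[OF L] by simp
  also have "\<dots> \<le> real (card (L \<inter> cube 0 (4 * covering_radius L))) * measure lebesgue (voronoi_cell L)"
    using covering_radius_pos[OF L] by (intro card_lattice_cube_ge[OF L]) simp
  finally show ?thesis using zero_less_mult_pos measure_nonneg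
    by (metis less_eq_real_def mult_zero_right)
qed

text \<open>The library proves that orthogonal maps preserve Lebesgue measure only for well-ordered index
  types; here Vitali coverings by balls, which orthogonal maps permute, give the inequality.\<close>

lemma measure_orthogonal_image_cbox_le:
  fixes g :: "'a::euclidean_space \<Rightarrow> 'a"
  assumes g: "orthogonal_transformation g"
  shows "measure lebesgue (g ` cbox a b) \<le> measure lebesgue (cbox a b)"
proof -
  let ?K = "{i. 0 < snd i \<and> ball (fst i) (snd i) \<subseteq> box a b}"
  have "\<exists>i. i \<in> ?K \<and> x \<in> ball (fst i) (snd i) \<and> snd i < d" if x: "x \<in> box a b" and d: "0 < d" for x d
  proof -
    obtain e where e: "e > 0" "ball x e \<subseteq> box a b"
      using x open_box by (meson openE)
    have "ball x (min e (d / 2)) \<subseteq> box a b" using e(2) by (rule order_trans[rotated]) (simp add: subset_ball)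
    then show ?thesis using e(1) d by (intro exI[of _ "(x, min e (d / 2))"]) auto
  qed
  then obtain C where C: "countable C" "C \<subseteq> ?K"
     "pairwise (\<lambda>i j. disjnt (ball (fst i) (snd i)) (ball (fst j) (snd j))) C"
     and neg: "negligible (box a b - (\<Union>i\<in>C. ball (fst i) (snd i)))"
    by (rule Vitali_covering_theorem_balls)
  \<comment> \<open>The part of the closed box missed by the disjoint balls, boundary included. It
    is null, and so is its image because \<open>g\<close> is 1-Lipschitz; up to null sets only balls
    remain, and \<open>g\<close> maps these to balls of equal radius.\<close>
  define N where "N = (box a b - (\<Union>i\<in>C. ball (fst i) (snd i))) \<union> (cbox a b - box a b)"
  have "negligible N" unfolding N_def
    by (intro negligible_Un neg negligible_frontier_interval)
  then have "negligible (g ` N)"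
  proof (rule negligible_locally_Lipschitz_image[OF order_refl])
    fix x
    have "norm (g y - g x) = norm (y - x)" for y
      using orthogonal_transformation_norm[OF g, of "y - x"] orthogonal_transformation_linear[OF g]
      by (simp add: linear_diff)
    then show "\<exists>T B. open T \<and> x \<in> T \<and> (\<forall>y\<in>N \<inter> T. norm (g y - g x) \<le> B * norm (y - x))"
      by (intro exI[of _ UNIV] exI[of _ 1]) auto
  qed
  then have null: "g ` N \<in> null_sets lebesgue" by (simp add: negligible_iff_null_sets)
  have disj: "disjoint_family_on (\<lambda>i. ball (fst i) (snd i)) C"
    using C(3) by (auto simp: disjoint_family_on_def pairwise_def disjnt_def)
  have gball: "g ` ball (fst i) (snd i) = ball (g (fst i)) (snd i)" for i
    by (rule image_orthogonal_transformation_ball[OF g])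
  have disj': "disjoint_family_on (\<lambda>i. ball (g (fst i)) (snd i)) C"
  proof (unfold disjoint_family_on_def, intro ballI impI)
    fix i j assume "i \<in> C" "j \<in> C" "i \<noteq> j"
    then have "ball (fst i) (snd i) \<inter> ball (fst j) (snd j) = {}"
      using disj by (simp add: disjoint_family_on_def)
    then show "ball (g (fst i)) (snd i) \<inter> ball (g (fst j)) (snd j) = {}"
      unfolding gball[symmetric] image_Int[OF orthogonal_transformation_inj[OF g], symmetric] by simp
  qed
  have eq: "emeasure lebesgue (ball (g (fst i)) (snd i)) = emeasure lebesgue (ball (fst i) (snd i))" if "i \<in> C" for i
    using C(2) that by (auto simp: emeasure_ball)
  have "g ` cbox a b \<subseteq> (\<Union>i\<in>C. ball (g (fst i)) (snd i)) \<union> g ` N"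
    unfolding N_def gball[symmetric] by blast
  then have "emeasure lebesgue (g ` cbox a b) \<le> emeasure lebesgue ((\<Union>i\<in>C. ball (g (fst i)) (snd i)) \<union> g ` N)"
    using null by (intro emeasure_mono sets.Un sets.countable_UN'' C(1)) auto
  also have "\<dots> = emeasure lebesgue (\<Union>i\<in>C. ball (g (fst i)) (snd i))"
    by (intro emeasure_Un_null_set null sets.countable_UN'' C(1)) auto
  also have "\<dots> = (\<integral>\<^sup>+i. emeasure lebesgue (ball (g (fst i)) (snd i)) \<partial>count_space C)"
    by (intro emeasure_UN_countable C(1) disj') auto
  also have "\<dots> = (\<integral>\<^sup>+i. emeasure lebesgue (ball (fst i) (snd i)) \<partial>count_space C)"
    by (intro nn_integral_cong eq) simp
  also have "\<dots> = emeasure lebesgue (\<Union>i\<in>C. ball (fst i) (snd i))"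
    by (intro emeasure_UN_countable[symmetric] C(1) disj) auto
  also have "\<dots> \<le> emeasure lebesgue (cbox a b)"
    using C(2) box_subset_cbox[of a b] by (intro emeasure_mono) auto
  finally have le: "emeasure lebesgue (g ` cbox a b) \<le> emeasure lebesgue (cbox a b)" .
  moreover have "compact (g ` cbox a b)"
    using linear_continuous_on[of g "cbox a b"] orthogonal_transformation_linear[OF g]
    by (intro compact_continuous_image compact_cbox) (auto simp: linear_conv_bounded_linear)
  ultimately show ?thesis
    by (simp add: emeasure_eq_measure2 lmeasurable_compact)
qed

section \<open>Lattice points in subspaces\<close>

lemma orthonormal_coordinates_adapted_to_subspace:
  fixes V :: "(real ^ 'n) set"
  assumes V: "subspace V"
  obtains \<beta> :: "'n \<Rightarrow> real ^ 'n"
  where "\<And>i j. \<beta> i \<bullet> \<beta> j = (if i = j then 1 else 0)"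
    and "\<And>i. \<beta> i \<in> V \<or> (\<forall>v\<in>V. v \<bullet> \<beta> i = 0)" and "card {i. \<beta> i \<in> V} = dim V"
proof -
  \<comment> \<open>Orthonormal bases of \<open>V\<close> and of its orthogonal complement together
    have \<open>CARD('n)\<close> elements, so their union can be indexed by the coordinate type
    \<open>'n\<close> itself.\<close>
  define V' where "V' = {y \<in> UNIV. \<forall>x\<in>V. orthogonal x y}"
  have V': "subspace V'" unfolding V'_def using subspace_orthogonal_to_vectors by auto
  have dim: "dim V' + dim V = CARD('n)"
    using dim_subspace_orthogonal_to_vectors[OF V subspace_UNIV] by (simp add: V'_def)
  obtain B where B: "B \<subseteq> V" "pairwise orthogonal B" "\<And>x. x \<in> B \<Longrightarrow> norm x = 1"
    "independent B" "card B = dim V"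
    using orthonormal_basis_subspace[OF V] by metis
  obtain B' where B': "B' \<subseteq> V'" "pairwise orthogonal B'" "\<And>x. x \<in> B' \<Longrightarrow> norm x = 1"
    "independent B'" "card B' = dim V'"
    using orthonormal_basis_subspace[OF V'] by metis
  have notV: "x \<notin> V" if "x \<in> B'" for x
  proof
    assume "x \<in> V"
    then have "orthogonal x x" using that B'(1) by (auto simp: V'_def)
    then have "x = 0" by (simp add: orthogonal_def)
    then show False using B'(3)[OF that] by simp
  qed
  have fin: "finite B" "finite B'" using B(4) B'(4) independent_imp_finite by auto
  have "B \<inter> B' = {}" using notV B(1) by blast
  then have "card (B \<union> B') = CARD('n)" using card_Un_disjoint[OF fin] B(5) B'(5) dim by simp
  then obtain \<beta> where \<beta>: "bij_betw \<beta> (UNIV :: 'n set) (B \<union> B')"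
    using fin finite_same_card_bij[of "UNIV :: 'n set" "B \<union> B'"] by auto
  have mem: "\<beta> i \<in> B \<union> B'" for i using \<beta> bij_betwE by blast
  have ort: "x \<bullet> y = 0" if xy: "x \<in> B \<union> B'" "y \<in> B \<union> B'" "x \<noteq> y" for x y
  proof -
    consider "x \<in> B" "y \<in> B" | "x \<in> B'" "y \<in> B'" | "x \<in> B" "y \<in> B'" | "x \<in> B'" "y \<in> B"
      using xy by blast
    then show ?thesis
    proof cases
      case 1 then show ?thesis using B(2) xy by (auto simp: pairwise_def orthogonal_def)
    next
      case 2 then show ?thesis using B'(2) xy by (auto simp: pairwise_def orthogonal_def)
    next
      case 3
      then have "x \<in> V" "y \<in> V'" using B(1) B'(1) by auto
      then show ?thesis by (simp add: V'_def orthogonal_def)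
    next
      case 4
      then have "y \<in> V" "x \<in> V'" using B(1) B'(1) by auto
      then show ?thesis by (simp add: V'_def orthogonal_def inner_commute[of x y])
    qed
  qed
  have "\<beta> i \<bullet> \<beta> j = (if i = j then 1 else 0)" for i j
  proof (cases "i = j")
    case True
    have "norm (\<beta> i) = 1" using mem[of i] B(3) B'(3) by blast
    then show ?thesis using True by (simp add: norm_eq_1)
  next
    case False
    then have "\<beta> i \<noteq> \<beta> j" using \<beta> by (auto simp: bij_betw_def inj_on_def)
    then show ?thesis using ort mem False by simp
  qed
  moreover have "\<beta> i \<in> V \<or> (\<forall>v\<in>V. v \<bullet> \<beta> i = 0)" for i
    using mem[of i] B(1) B'(1) by (auto simp: V'_def orthogonal_def)
  moreover have "card {i. \<beta> i \<in> V} = dim V"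
  proof -
    have "\<beta> ` {i. \<beta> i \<in> V} = B"
    proof (rule subset_antisym)
      show "\<beta> ` {i. \<beta> i \<in> V} \<subseteq> B" using mem notV by blast
      show "B \<subseteq> \<beta> ` {i. \<beta> i \<in> V}"
      proof
        fix b assume b: "b \<in> B"
        then have "b \<in> range \<beta>" using \<beta> by (auto simp: bij_betw_def)
        then show "b \<in> \<beta> ` {i. \<beta> i \<in> V}" using b B(1) by blast
      qed
    qed
    moreover have "inj_on \<beta> {i. \<beta> i \<in> V}" using \<beta> by (auto simp: bij_betw_def inj_on_def)
    ultimately show ?thesis using card_image B(5) by metis
  qed
  ultimately show ?thesis using that by blast
qed

text \<open>In orthonormal coordinates adapted to \<open>V\<close> the cells around the counted
  points lie in a box: orthogonally to \<open>V\<close> the points have coordinate 0 and the cells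
  reach at most the covering radius, while along \<open>V\<close> the extent is bounded by the
  diagonal of the cube plus the covering radius.\<close>

lemma card_lattice_subspace_cube_le:
  fixes L V :: "(real ^ 'n) set"
  assumes L: "full_rank_lattice L" and V: "subspace V" and B: "0 \<le> B"
  shows "real (card (L \<inter> V \<inter> cube 0 B)) * measure lebesgue (voronoi_cell L)
     \<le> (sqrt (real CARD('n)) * (B + 2 * covering_radius L)) ^ dim V
        * (2 * covering_radius L) ^ (CARD('n) - dim V)"
proof -
  let ?r = "covering_radius L" and ?n = "real CARD('n)"
  obtain \<beta> :: "'n \<Rightarrow> real ^ 'n"
    where on: "\<And>i j. \<beta> i \<bullet> \<beta> j = (if i = j then 1 else 0)"
      and V\<beta>: "\<And>i. \<beta> i \<in> V \<or> (\<forall>v\<in>V. v \<bullet> \<beta> i = 0)" and card: "card {i. \<beta> i \<in> V} = dim V"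
    using orthonormal_coordinates_adapted_to_subspace[OF V] by blast
  have r: "?r > 0" by (rule covering_radius_pos[OF L])
  define g where "g y = (\<Sum>i\<in>UNIV. y $ i *\<^sub>R \<beta> i)" for y :: "real ^ 'n"
  have lin: "linear g"
    by (rule linearI) (simp_all add: g_def algebra_simps sum.distrib scaleR_sum_right)
  have g\<beta>: "g y \<bullet> \<beta> i = y $ i" for y i
    by (simp add: g_def inner_sum_left on if_distrib cong: if_cong)
  have gg: "g v \<bullet> g w = v \<bullet> w" for v w
  proof -
    have "g v \<bullet> g w = (\<Sum>i\<in>UNIV. w $ i * (g v \<bullet> \<beta> i))"
      unfolding g_def[of w] by (simp add: inner_sum_right)
    also have "\<dots> = v \<bullet> w"
      unfolding g\<beta> by (simp add: inner_vec_def mult.commute)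
    finally show ?thesis .
  qed
  have orth: "orthogonal_transformation g"
    using lin gg by (simp add: orthogonal_transformation_def)
  \<comment> \<open>The cube has centre \<open>m\<close> and half-diagonal
    \<open>sqrt n * (B / 2)\<close>. In \<open>h\<close> the covering radius is also multiplied by
    \<open>sqrt n\<close>, which only enlarges the box and gives the factored form of the
    bound.\<close>
  define m :: "real ^ 'n" where "m = (\<chi> i. B / 2)"
  define h where "h = sqrt ?n * (B / 2 + ?r)"
  define lo hi where "lo = (\<chi> i. if \<beta> i \<in> V then m \<bullet> \<beta> i - h else - ?r)"
    and "hi = (\<chi> i. if \<beta> i \<in> V then m \<bullet> \<beta> i + h else ?r)"
  have h: "h \<ge> 0" using B r by (simp add: h_def)
  have sq: "sqrt ?n \<ge> 1" by (simp add: Suc_leI)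
  have "real (card (L \<inter> V \<inter> cube 0 B)) * measure lebesgue (voronoi_cell L) \<le> measure lebesgue (g ` cbox lo hi)"
  proof (rule card_lattice_times_covolume_le[OF L])
    show "finite (L \<inter> V \<inter> cube 0 B)"
      using full_rank_lattice_finite_Int[OF L bounded_cube] by (rule rev_finite_subset) blast
    show "g ` cbox lo hi \<in> lmeasurable"
      using linear_continuous_on[of g "cbox lo hi"] lin
      by (intro lmeasurable_compact compact_continuous_image compact_cbox) (auto simp: linear_conv_bounded_linear)
    fix l c :: "real ^ 'n" assume l: "l \<in> L \<inter> V \<inter> cube 0 B" and c: "norm c \<le> ?r"
    obtain y where y: "l + c = g y"
      using orthogonal_transformation_surj[OF orth] by (metis surjD)
    have n\<beta>: "norm (\<beta> i) = 1" for i using on[of i i] by (simp add: norm_eq_1)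
    have "lo $ i \<le> y $ i \<and> y $ i \<le> hi $ i" for i
    proof (cases "\<beta> i \<in> V")
      case True
      have "norm (l - m) \<le> sqrt ?n * (B / 2)"
      proof -
        have "\<bar>(l - m) $ j\<bar> \<le> B / 2" for j
          using l by (auto simp: cube_def m_def abs_le_iff field_simps dest!: spec[of _ j])
        then have "(norm (l - m))\<^sup>2 \<le> (\<Sum>j\<in>(UNIV :: 'n set). (B / 2)\<^sup>2)"
          unfolding norm_vec_def L2_set_def
          by (simp add: sum_nonneg) (intro sum_bounded_above, simp add: abs_le_square_iff[symmetric] B)
        also have "\<dots> = (sqrt ?n * (B / 2))\<^sup>2"
          unfolding power_mult_distrib by simp
        finally show ?thesis by (rule power2_le_imp_le) (simp add: B)
      qed
      then have "norm (l + c - m) \<le> sqrt ?n * (B / 2) + ?r"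
        using norm_triangle_ineq[of "l - m" c] c by (simp add: algebra_simps)
      also have "\<dots> \<le> h" using sq r mult_right_mono[of 1 "sqrt ?n" ?r] by (simp add: h_def algebra_simps)
      finally have "\<bar>(l + c - m) \<bullet> \<beta> i\<bar> \<le> h"
        using Cauchy_Schwarz_ineq2[of "l + c - m" "\<beta> i"] n\<beta>[of i] by simp
      moreover have "(l + c - m) \<bullet> \<beta> i = y $ i - m \<bullet> \<beta> i"
        unfolding y by (simp add: inner_diff_left g\<beta>)
      ultimately show ?thesis using True by (simp add: lo_def hi_def abs_le_iff)
    next
      case False
      then have "l \<bullet> \<beta> i = 0" using V\<beta> l by blast
      then have "y $ i = c \<bullet> \<beta> i" using g\<beta>[of y i] unfolding y[symmetric] by (simp add: inner_add_left)
      moreover have "\<bar>c \<bullet> \<beta> i\<bar> \<le> ?r"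
        using Cauchy_Schwarz_ineq2[of c "\<beta> i"] n\<beta>[of i] c by simp
      ultimately show ?thesis using False by (simp add: lo_def hi_def abs_le_iff)
    qed
    then show "l + c \<in> g ` cbox lo hi" unfolding y by (auto simp: mem_box_cart)
  qed auto
  also have "measure lebesgue (g ` cbox lo hi) \<le> measure lebesgue (cbox lo hi)"
    by (rule measure_orthogonal_image_cbox_le[OF orth])
  also have "\<dots> = (\<Prod>i\<in>UNIV. hi $ i - lo $ i)"
  proof -
    have "lo $ i \<le> hi $ i" for i using h r by (simp add: lo_def hi_def)
    then have "cbox lo hi \<noteq> {}" by (subst interval_ne_empty_cart(1)) simp
    then have "measure lborel (cbox lo hi) = (\<Prod>i\<in>UNIV. hi $ i - lo $ i)"
      by (rule content_cbox_cart)
    then show ?thesis by (simp only: measure_completion sets_lborel borel_closed closed_cbox)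
  qed
  also have "\<dots> = (\<Prod>i\<in>UNIV. if \<beta> i \<in> V then 2 * h else 2 * ?r)"
    by (intro prod.cong) (auto simp: lo_def hi_def)
  also have "\<dots> = (2 * h) ^ dim V * (2 * ?r) ^ card {i. \<beta> i \<notin> V}"
    by (subst prod.If_cases) (simp_all add: card Collect_neg_eq)
  also have "card {i. \<beta> i \<notin> V} = CARD('n) - dim V"
    using card_Diff_subset[of "{i. \<beta> i \<in> V}" UNIV] card by (simp add: Collect_neg_eq Compl_eq_Diff_UNIV)
  also have "2 * h = sqrt ?n * (B + 2 * ?r)" by (simp add: h_def algebra_simps)
  finally show ?thesis .
qed

section \<open>Linearly independent sequences\<close>

text \<open>Stated prefix by prefix to match vectors drawn one after the other; repetitions are
  excluded as well, since a repeated vector lies in the span of the earlier ones.\<close>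

definition indep_seq :: "(nat \<Rightarrow> 'a::real_vector) \<Rightarrow> nat \<Rightarrow> bool" where
  "indep_seq xs m \<longleftrightarrow> (\<forall>k<m. xs k \<notin> span (xs ` {..<k}))"

lemma indep_seq_0 [simp]: "indep_seq xs 0"
  by (simp add: indep_seq_def)

lemma indep_seq_Suc: "indep_seq xs (Suc m) \<longleftrightarrow> indep_seq xs m \<and> xs m \<notin> span (xs ` {..<m})"
  unfolding indep_seq_def less_Suc_eq by blast

lemma indep_seq_cong:
  assumes "\<And>i. i < m \<Longrightarrow> xs i = ys i"
  shows "indep_seq xs m \<longleftrightarrow> indep_seq ys m"
proof -
  have "xs ` {..<k} = ys ` {..<k}" if "k < m" for k
    using assms that by (intro image_cong) auto
  then show ?thesis using assms by (simp add: indep_seq_def)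
qed

lemma indep_seq_imp_independent:
  "indep_seq xs m \<Longrightarrow> inj_on xs {..<m} \<and> independent (xs ` {..<m})"
proof (induction m)
  case (Suc m)
  then have IH: "inj_on xs {..<m}" "independent (xs ` {..<m})" and n: "xs m \<notin> span (xs ` {..<m})"
    by (auto simp: indep_seq_Suc)
  from n have "xs m \<notin> xs ` {..<m}" using span_base[of "xs m" "xs ` {..<m}"] by blast
  then show ?case using IH n by (simp add: lessThan_Suc independent_insertI)
qed (simp add: independent_empty)

lemma indep_seq_dim: "indep_seq xs m \<Longrightarrow> dim (span (xs ` {..<m})) = m"
  using indep_seq_imp_independent[of xs m] dim_eq_card_independent[of "xs ` {..<m}"]
  by (simp add: card_image)

text \<open>An independent prefix of length \<open>k\<close> is extended by any element of
  \<open>S\<close> outside its span, and \<open>r k\<close> bounds the fraction of \<open>S\<close>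
  inside. \<open>r k <= 1\<close> keeps the factor \<open>1 - r k\<close> nonnegative, so that the
  induction hypothesis can be multiplied by it.\<close>

lemma card_indep_seqs_ge:
  fixes S :: "'a::real_vector set" and r :: "nat \<Rightarrow> real"
  assumes S: "finite S"
    and le: "\<And>k xs. k < m \<Longrightarrow> xs \<in> PiE {..<k} (\<lambda>_. S) \<Longrightarrow> indep_seq xs k
               \<Longrightarrow> real (card (S \<inter> span (xs ` {..<k}))) \<le> r k * real (card S)"
    and r: "\<And>k. k < m \<Longrightarrow> r k \<le> 1"
  shows "real (card S) ^ m * (\<Prod>k<m. 1 - r k) \<le> real (card {xs \<in> PiE {..<m} (\<lambda>_. S). indep_seq xs m})"
  using le r
proof (induction m)
  case 0
  have "{xs \<in> PiE {..<0::nat} (\<lambda>_. S). indep_seq xs 0} = {\<lambda>_. undefined}" by auto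
  then show ?case by simp
next
  case (Suc m)
  define G where "G m = {xs \<in> PiE {..<m} (\<lambda>_. S). indep_seq xs m}" for m
  have finG: "finite (G m)" for m
    unfolding G_def by (rule finite_subset[OF _ finite_PiE[of "{..<m}" "\<lambda>_. S"]]) (auto simp: S)
  have IH: "real (card S) ^ m * (\<Prod>k<m. 1 - r k) \<le> real (card (G m))"
    unfolding G_def by (rule Suc.IH) (use Suc.prems in auto)
  define E where "E xs = S - span (xs ` {..<m})" for xs :: "nat \<Rightarrow> 'a"
  define f where "f p = (fst p)(m := snd p)" for p :: "(nat \<Rightarrow> 'a) \<times> 'a"
  have E: "real (card S) * (1 - r m) \<le> real (card (E xs))" if "xs \<in> G m" for xs
  proof -
    have "real (card (S \<inter> span (xs ` {..<m}))) \<le> r m * real (card S)"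
      using Suc.prems(1)[of m xs] that by (simp add: G_def)
    moreover have "card (E xs) = card S - card (S \<inter> span (xs ` {..<m}))"
      unfolding E_def using S by (simp add: card_Diff_subset_Int)
    moreover have "card (S \<inter> span (xs ` {..<m})) \<le> card S" using S by (intro card_mono) auto
    ultimately show ?thesis by (simp add: of_nat_diff algebra_simps)
  qed
  have "f ` Sigma (G m) E \<subseteq> G (Suc m)"
  proof (rule image_subsetI)
    fix p assume p: "p \<in> Sigma (G m) E"
    obtain xs y where xy: "p = (xs, y)" by (cases p)
    have "xs \<in> G m" "y \<in> E xs" using p unfolding xy by (rule SigmaD1, rule SigmaD2)
    then have xs: "xs \<in> PiE {..<m} (\<lambda>_. S)" "indep_seq xs m" and y: "y \<in> S" "y \<notin> span (xs ` {..<m})"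
      unfolding G_def E_def by simp_all
    have "xs(m := y) ` {..<m} = xs ` {..<m}" by auto
    then have "indep_seq (xs(m := y)) (Suc m)"
      using xs y indep_seq_cong[of m "xs(m := y)" xs] by (simp add: indep_seq_Suc)
    moreover have "xs(m := y) \<in> PiE {..<Suc m} (\<lambda>_. S)"
      using xs(1) y(1) unfolding lessThan_Suc by (rule PiE_fun_upd[rotated])
    ultimately show "f p \<in> G (Suc m)" by (simp add: G_def f_def xy)
  qed
  moreover have "inj_on f (Sigma (G m) E)"
  proof (rule inj_onI)
    fix p q assume pq: "p \<in> Sigma (G m) E" "q \<in> Sigma (G m) E" "f p = f q"
    have "fst p \<in> G m" using pq(1) by (cases p) simp
    moreover have "fst q \<in> G m" using pq(2) by (cases q) simp
    ultimately have P: "fst p \<in> PiE {..<m} (\<lambda>_. S)" "fst q \<in> PiE {..<m} (\<lambda>_. S)"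
      unfolding G_def by simp_all
    have "snd p = snd q" using fun_cong[OF pq(3), of m] by (simp add: f_def)
    moreover have "fst p = fst q"
    proof (rule PiE_ext[OF P])
      fix i assume "i \<in> {..<m}"
      then show "fst p i = fst q i" using fun_cong[OF pq(3), of i] by (simp add: f_def)
    qed
    ultimately show "p = q" by (simp add: prod_eq_iff)
  qed
  ultimately have "card (Sigma (G m) E) \<le> card (G (Suc m))"
    by (intro card_inj_on_le[OF _ _ finG])
  then have "(\<Sum>xs\<in>G m. real (card (E xs))) \<le> real (card (G (Suc m)))"
    using finG S by (simp add: E_def card_SigmaI flip: of_nat_sum)
  moreover have "real (card (G m)) * (real (card S) * (1 - r m)) \<le> (\<Sum>xs\<in>G m. real (card (E xs)))"
    using sum_mono[of "G m" "\<lambda>_. real (card S) * (1 - r m)", OF E] by simp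
  moreover have "real (card S) ^ m * (\<Prod>k<m. 1 - r k) * (real (card S) * (1 - r m))
      \<le> real (card (G m)) * (real (card S) * (1 - r m))"
    using Suc.prems(2)[of m] by (intro mult_right_mono IH) auto
  ultimately show ?case by (simp add: G_def algebra_simps)
qed

section \<open>Generating a lattice over a sublattice\<close>

text \<open>Fixes an outcome of the first \<open>n\<close> draws that is linearly independent;
  generation of \<open>L\<close> is then studied modulo the sublattice spanned by it.\<close>

locale sublattice_basis =
  fixes L :: "(real ^ 'n) set" and xs :: "nat \<Rightarrow> real ^ 'n"
  assumes L: "full_rank_lattice L"
    and xs_L: "\<And>i. i < CARD('n) \<Longrightarrow> xs i \<in> L"
    and indep: "indep_seq xs CARD('n)"
begin

section \<open>Coordinates and reduction modulo the sublattice\<close>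

definition coord :: "real ^ 'n \<Rightarrow> nat \<Rightarrow> real" where
  "coord x i = representation (xs ` {..<CARD('n)}) x (xs i)"

lemma inj_xs: "inj_on xs {..<CARD('n)}" and independent_xs: "independent (xs ` {..<CARD('n)})"
  using indep_seq_imp_independent[OF indep] by auto

lemma span_xs: "span (xs ` {..<CARD('n)}) = UNIV"
proof -
  have "dim (span (xs ` {..<CARD('n)})) = dim (UNIV :: (real ^ 'n) set)"
    using indep_seq_dim[OF indep] by simp
  then show ?thesis
    by (intro subspace_dim_equal) auto
qed

lemma coord_sum: "(\<Sum>i<CARD('n). coord x i *\<^sub>R xs i) = x"
proof -
  have "(\<Sum>i<CARD('n). coord x i *\<^sub>R xs i)
      = (\<Sum>b\<in>xs ` {..<CARD('n)}. representation (xs ` {..<CARD('n)}) x b *\<^sub>R b)"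
    unfolding coord_def by (subst sum.reindex[OF inj_xs]) (simp add: o_def)
  also have "\<dots> = x"
    using independent_xs span_xs by (intro real_vector.sum_representation_eq) auto
  finally show ?thesis .
qed

lemma coord_add: "coord (x + y) i = coord x i + coord y i"
  unfolding coord_def using representation_add[OF independent_xs, of y x] span_xs by simp

lemma coord_scaleR: "coord (c *\<^sub>R x) i = c * coord x i"
  unfolding coord_def using representation_scale[OF independent_xs, of x c] span_xs by simp

lemma coord_minus: "coord (- x) i = - coord x i"
  using coord_scaleR[of "-1" x i] by simp

lemma coord_diff: "coord (x - y) i = coord x i - coord y i"
  using coord_add[of x "- y" i] by (simp add: coord_minus)

lemma coord_basis:
  assumes "i < CARD('n)" "j < CARD('n)"
  shows "coord (xs j) i = (if i = j then 1 else 0)"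
proof -
  have "representation (xs ` {..<CARD('n)}) (xs j) = (\<lambda>v. if v = xs j then 1 else 0)"
    using assms by (intro representation_basis independent_xs) auto
  then show ?thesis
    unfolding coord_def using inj_on_eq_iff[OF inj_xs, of i j] assms by simp
qed

definition sublattice :: "(real ^ 'n) set" where
  "sublattice = add_subgroup_generated (xs ` {..<CARD('n)})"

text \<open>Reduction into the half-open fundamental parallelepiped of \<open>xs\<close>; it will
  play the part of \<open>rho\<close>.\<close>

definition frac_part :: "real ^ 'n \<Rightarrow> real ^ 'n" where
  "frac_part x = (\<Sum>i<CARD('n). frac (coord x i) *\<^sub>R xs i)"

lemma coord_sublattice_Ints:
  assumes "x \<in> sublattice" "i < CARD('n)"
  shows "coord x i \<in> \<int>"
proof -
  have "add_subgroup {x. \<forall>i<CARD('n). coord x i \<in> \<int>}"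
    using coord_scaleR[of 0 0] by (auto simp: add_subgroup_def coord_add coord_minus)
  moreover have "xs ` {..<CARD('n)} \<subseteq> {x. \<forall>i<CARD('n). coord x i \<in> \<int>}"
    by (auto simp: coord_basis)
  ultimately have "sublattice \<subseteq> {x. \<forall>i<CARD('n). coord x i \<in> \<int>}"
    unfolding sublattice_def by (intro add_subgroup_generated_minimal)
  then show ?thesis using assms by blast
qed

text \<open>\<open>x - frac_part x\<close> has the floors as coordinates. Conversely, elements of
  the sublattice have integer coordinates, which do not change fractional parts.\<close>

sublocale quotient_representatives sublattice frac_part
proof
  show "add_subgroup sublattice" by (simp add: sublattice_def)
  show "x - frac_part x \<in> sublattice" for x
  proof -
    have "x - frac_part x = (\<Sum>i<CARD('n). coord x i *\<^sub>R xs i) - frac_part x" by (simp add: coord_sum)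
    also have "\<dots> = (\<Sum>i<CARD('n). of_int \<lfloor>coord x i\<rfloor> *\<^sub>R xs i)"
      by (simp add: frac_part_def frac_def algebra_simps flip: sum_subtractf)
    also have "\<dots> \<in> sublattice"
      unfolding sublattice_def using subset_add_subgroup_generated[of "xs ` {..<CARD('n)}"]
      by (intro add_subgroup_sum add_subgroup_scaleR_int) auto
    finally show ?thesis .
  qed
  show "frac_part x = frac_part y" if "x - y \<in> sublattice" for x y
    unfolding frac_part_def
  proof (rule sum.cong[OF refl])
    fix i assume "i \<in> {..<CARD('n)}"
    then have "coord x i - coord y i \<in> \<int>"
      using coord_sublattice_Ints[OF that, of i] by (simp add: coord_diff)
    then obtain z where "coord x i = coord y i + of_int z"
      by (metis Ints_cases add.commute diff_add_cancel)
    then show "frac (coord x i) *\<^sub>R xs i = frac (coord y i) *\<^sub>R xs i"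
      by (simp add: frac_def)
  qed
qed

lemma subgroup_L: "add_subgroup L"
  by (rule full_rank_lattice_subgroup[OF L])

lemma sublattice_subset: "sublattice \<subseteq> L"
  unfolding sublattice_def using xs_L by (intro add_subgroup_generated_minimal subgroup_L) auto

text \<open>The sublattice has finite index: the transversal consists of the lattice points of the
  bounded parallelepiped.\<close>

lemma finite_reps: "finite (reps L)"
proof -
  have "norm x \<le> (\<Sum>i<CARD('n). norm (xs i))" if "frac_part x = x" for x
  proof -
    have "norm (frac_part x) \<le> (\<Sum>i<CARD('n). norm (frac (coord x i) *\<^sub>R xs i))"
      unfolding frac_part_def by (rule norm_sum)
    also have "\<dots> \<le> (\<Sum>i<CARD('n). norm (xs i))"
      by (intro sum_mono) (simp add: mult_left_le_one_le frac_lt_1 less_imp_le)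
    finally show ?thesis using that by simp
  qed
  then have "bounded {x. frac_part x = x}" by (auto simp: bounded_iff)
  then have "finite (L \<inter> {x. frac_part x = x})" by (rule full_rank_lattice_finite_Int[OF L])
  moreover have "reps L = L \<inter> {x. frac_part x = x}" by (auto simp: reps_def)
  ultimately show ?thesis by simp
qed

lemma coord_frac_part: "i < CARD('n) \<Longrightarrow> coord (frac_part x) i = frac (coord x i)"
proof -
  assume i: "i < CARD('n)"
  have fin: "coord (\<Sum>j\<in>J. c j *\<^sub>R xs j) i = (\<Sum>j\<in>J. c j * coord (xs j) i)" if "finite J" for J c
    using that by (induction J rule: finite_induct) (use coord_scaleR[of 0 0] in \<open>auto simp: coord_add coord_scaleR\<close>)
  have "coord (frac_part x) i = (\<Sum>j<CARD('n). frac (coord x j) * coord (xs j) i)"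
    unfolding frac_part_def by (rule fin) simp
  also have "\<dots> = (\<Sum>j<CARD('n). if j = i then frac (coord x j) else 0)"
    using i by (intro sum.cong) (auto simp: coord_basis)
  also have "\<dots> = frac (coord x i)" using i by simp
  finally show ?thesis .
qed

text \<open>The least positive \<open>j\<close>-th coordinate exists because, up to 1, only finitely
  many values occur: a value below 1 is its own fractional part, hence the \<open>j\<close>-th
  coordinate of a representative. The value 1 itself is attained by \<open>xs j\<close>.\<close>

lemma minimal_coordinate_vector:
  assumes j: "j < CARD('n)"
  shows "\<exists>b\<in>L. (\<forall>i. j < i \<and> i < CARD('n) \<longrightarrow> coord b i = 0) \<and> 0 < coord b j \<and>
    (\<forall>x\<in>L. (\<forall>i. j < i \<and> i < CARD('n) \<longrightarrow> coord x i = 0) \<longrightarrow> 0 < coord x j \<longrightarrow> coord b j \<le> coord x j)"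
proof -
  define A where "A = {x \<in> L. \<forall>i. j < i \<and> i < CARD('n) \<longrightarrow> coord x i = 0}"
  define S where "S = {coord x j |x. x \<in> A \<and> 0 < coord x j \<and> coord x j \<le> 1}"
  have "S \<subseteq> insert 1 ((\<lambda>x. coord x j) ` reps L)"
  proof
    fix s assume "s \<in> S"
    then obtain x where x: "x \<in> A" "s = coord x j" "0 < s" "s \<le> 1" by (auto simp: S_def)
    show "s \<in> insert 1 ((\<lambda>x. coord x j) ` reps L)"
    proof (cases "s = 1")
      case False
      then have "coord (frac_part x) j = s" using x j by (simp add: coord_frac_part frac_eq)
      moreover have "frac_part x \<in> reps L"
        using x by (intro rho_in_reps subgroup_L sublattice_subset) (auto simp: A_def)
      ultimately show ?thesis by blast
    qed simp
  qed
  then have finS: "finite S" using finite_reps finite_subset by blast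
  have "xs j \<in> A" using j xs_L by (auto simp: A_def coord_basis)
  moreover have "coord (xs j) j = 1" using j by (simp add: coord_basis)
  ultimately have "1 \<in> S" unfolding S_def by (auto intro!: exI[of _ "xs j"])
  then have "Min S \<in> S" using finS by (intro Min_in) auto
  then obtain b where b: "b \<in> A" "coord b j = Min S" "0 < coord b j" "coord b j \<le> 1"
    by (auto simp: S_def)
  have "coord b j \<le> coord x j" if x: "x \<in> A" "0 < coord x j" for x
  proof (cases "coord x j \<le> 1")
    case True
    then have "coord x j \<in> S" using x by (auto simp: S_def)
    then show ?thesis using b finS by simp
  qed (use b in simp)
  then show ?thesis using b unfolding A_def by blast
qed

text \<open>A triangular basis as in the Hermite normal form, with minimal positive diagonal
  entries. Coordinates are cleared from the last to the first by division with remainder; the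
  remainder is smaller than the minimal entry and so vanishes.\<close>

lemma exists_generators: "\<exists>b. gen {..<CARD('n)} b = L"
proof -
  have "\<exists>b. \<forall>j<CARD('n). b j \<in> L \<and> (\<forall>i. j < i \<and> i < CARD('n) \<longrightarrow> coord (b j) i = 0) \<and> 0 < coord (b j) j \<and>
    (\<forall>x\<in>L. (\<forall>i. j < i \<and> i < CARD('n) \<longrightarrow> coord x i = 0) \<longrightarrow> 0 < coord x j \<longrightarrow> coord (b j) j \<le> coord x j)"
    using minimal_coordinate_vector by (intro choice) blast
  then obtain b where B: "\<forall>j<CARD('n). b j \<in> L \<and> (\<forall>i. j < i \<and> i < CARD('n) \<longrightarrow> coord (b j) i = 0) \<and> 0 < coord (b j) j \<and>
    (\<forall>x\<in>L. (\<forall>i. j < i \<and> i < CARD('n) \<longrightarrow> coord x i = 0) \<longrightarrow> 0 < coord x j \<longrightarrow> coord (b j) j \<le> coord x j)"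
    by (rule exE)
  have b: "b j \<in> L" "0 < coord (b j) j" if "j < CARD('n)" for j
    using B that by simp_all
  have b0: "coord (b j) i = 0" if "j < i" "i < CARD('n)" for i j
    using B less_trans[OF that] that by simp
  have bmin: "coord (b j) j \<le> coord x j"
    if "j < CARD('n)" "x \<in> L" "\<And>i. j < i \<Longrightarrow> i < CARD('n) \<Longrightarrow> coord x i = 0" "0 < coord x j" for j x
    using B that by simp
  have "x \<in> gen {..<CARD('n)} b" if "m \<le> CARD('n)" "x \<in> L" "\<And>i. m \<le> i \<Longrightarrow> i < CARD('n) \<Longrightarrow> coord x i = 0" for m x
    using that
  proof (induction m arbitrary: x)
    case 0
    then have "(\<Sum>i<CARD('n). coord x i *\<^sub>R xs i) = 0" by (intro sum.neutral) auto
    then have "x = 0" by (simp add: coord_sum)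
    then show ?case by (simp add: add_subgroup_0)
  next
    case (Suc m)
    have m: "m < CARD('n)" using Suc.prems by simp
    define z where "z = \<lfloor>coord x m / coord (b m) m\<rfloor>"
    define y where "y = x - of_int z *\<^sub>R b m"
    have yL: "y \<in> L" unfolding y_def using Suc.prems b m
      by (intro add_subgroup_diff[OF subgroup_L] add_subgroup_scaleR_int[OF subgroup_L])
    have y0: "coord y i = 0" if "m < i" "i < CARD('n)" for i
      using Suc.prems(3)[of i] b0[of m i] that by (simp add: y_def coord_diff coord_scaleR)
    have ym: "coord y m = coord x m - of_int z * coord (b m) m"
      by (simp add: y_def coord_diff coord_scaleR)
    have "of_int z \<le> coord x m / coord (b m) m" "coord x m / coord (b m) m < of_int z + 1"
      unfolding z_def by linarith+
    then have "0 \<le> coord y m" "coord y m < coord (b m) m"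
      using b(2)[OF m] unfolding ym by (simp_all add: field_simps)
    then have "coord y m = 0" using bmin[OF m yL y0] by linarith
    then have "y \<in> gen {..<CARD('n)} b"
      using y0 m yL by (intro Suc.IH) (auto simp: le_less)
    moreover have "b m \<in> gen {..<CARD('n)} b" using m by (intro gen_mem) simp
    ultimately have "y + of_int z *\<^sub>R b m \<in> gen {..<CARD('n)} b"
      by (intro add_subgroup_add add_subgroup_scaleR_int) auto
    then show ?case by (simp add: y_def)
  qed
  then have "L \<subseteq> gen {..<CARD('n)} b" by force
  moreover have "gen {..<CARD('n)} b \<subseteq> L"
    using b(1) sublattice_subset by (subst gen_subset_iff[OF subgroup_L]) auto
  ultimately show ?thesis by blast
qed

lemma gen_eq: "gen I y = add_subgroup_generated (xs ` {..<CARD('n)} \<union> y ` I)"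
  unfolding gen_def
proof (rule add_subgroup_generated_eqI)
  have *: "xs ` {..<CARD('n)} \<union> y ` I \<subseteq> add_subgroup_generated (xs ` {..<CARD('n)} \<union> y ` I)"
    by (rule subset_add_subgroup_generated)
  then have "sublattice \<subseteq> add_subgroup_generated (xs ` {..<CARD('n)} \<union> y ` I)"
    unfolding sublattice_def by (intro add_subgroup_generated_minimal) auto
  then show "sublattice \<union> y ` I \<subseteq> add_subgroup_generated (xs ` {..<CARD('n)} \<union> y ` I)"
    using * by blast
  have "xs ` {..<CARD('n)} \<subseteq> sublattice"
    unfolding sublattice_def by (rule subset_add_subgroup_generated)
  then show "xs ` {..<CARD('n)} \<union> y ` I \<subseteq> add_subgroup_generated (sublattice \<union> y ` I)"
    using subset_add_subgroup_generated[of "sublattice \<union> y ` I"] by blast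
qed

text \<open>\<open>T\<close> collects the translations of the parallelepiped whose lattice points
  all stay in the large cube. On the sums \<open>h + r\<close> with \<open>h\<close> in
  \<open>T\<close> and \<open>r\<close> a representative, every class occurs exactly
  \<open>card T\<close> times, so generating tuples of classes lift in
  \<open>card T ^ (n + 1)\<close> ways. The inner cube lies within these sums, which bounds
  \<open>card T * card (reps L)\<close> from below.\<close>

lemma card_generating_tuples_cube_ge:
  assumes B: "0 < B" "\<And>i. i < CARD('n) \<Longrightarrow> xs i \<in> cube 0 B"
  shows "real (card (L \<inter> cube (real CARD('n) * B) (B1 - 2 * real CARD('n) * B))) ^ (CARD('n) + 1)
           * (\<Prod>i = 2..CARD('n) + 1. 1 / zeta_real (real i))
    \<le> real (card {ys \<in> PiE {..<CARD('n) + 1} (\<lambda>_. L \<inter> cube 0 B1).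
          add_subgroup_generated (xs ` {..<CARD('n)} \<union> ys ` {..<CARD('n) + 1}) = L})"
proof -
  let ?I = "{..<CARD('n) + 1}" and ?Z = "\<Prod>i = 2..CARD('n) + 1. 1 / zeta_real (real i)"
  let ?S = "L \<inter> cube 0 B1" and ?R = "reps L"
  let ?In = "L \<inter> cube (real CARD('n) * B) (B1 - 2 * real CARD('n) * B)"
  define T where "T = {h \<in> sublattice. \<forall>r\<in>?R. h + r \<in> cube 0 B1}"
  \<comment> \<open>A representative combines \<open>n\<close> vectors with entries in
    \<open>[0, B)\<close> using coefficients in \<open>[0, 1)\<close>; this is the origin of the
    margin \<open>n * B\<close> of the inner cube.\<close>
  have R_coord: "0 \<le> r $ j \<and> r $ j \<le> real CARD('n) * B" if "r \<in> ?R" for r j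
  proof -
    have "r $ j = frac_part r $ j" using that by (simp add: reps_def)
    also have "\<dots> = (\<Sum>i<CARD('n). frac (coord r i) * xs i $ j)" by (simp add: frac_part_def)
    finally have r: "r $ j = (\<Sum>i<CARD('n). frac (coord r i) * xs i $ j)" .
    have x: "0 \<le> xs i $ j" "xs i $ j \<le> B" if "i < CARD('n)" for i
      using B(2)[OF that] by (auto simp: cube_def less_imp_le)
    have "(\<Sum>i<CARD('n). frac (coord r i) * xs i $ j) \<le> (\<Sum>i<CARD('n). 1 * B)"
      using x B by (intro sum_mono mult_mono) (auto simp: frac_lt_1 less_imp_le)
    moreover have "0 \<le> (\<Sum>i<CARD('n). frac (coord r i) * xs i $ j)"
      using x by (intro sum_nonneg mult_nonneg_nonneg) auto
    ultimately show ?thesis unfolding r by simp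
  qed
  have "0 \<in> ?R"
    using add_subgroup_0[OF subgroup_L] coord_scaleR[of 0 0] by (simp add: reps_def frac_part_def)
  then have "T \<subseteq> ?S" using sublattice_subset by (force simp: T_def)
  moreover have finS: "finite ?S" by (rule full_rank_lattice_finite_Int[OF L bounded_cube])
  ultimately have finT: "finite T" using finite_subset by blast
  \<comment> \<open>Replacing \<open>frac_part x\<close> by another representative moves each
    coordinate by at most \<open>n * B\<close>, so a point of the inner cube does not leave the
    large cube.\<close>
  have "(\<lambda>x. (x - frac_part x, frac_part x)) ` ?In \<subseteq> T \<times> ?R"
  proof (rule image_subsetI)
    fix x assume x: "x \<in> ?In"
    have fx: "frac_part x \<in> ?R" using x by (intro rho_in_reps subgroup_L sublattice_subset) auto
    have "x - frac_part x + r \<in> cube 0 B1" if "r \<in> ?R" for r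
      unfolding cube_def
    proof (intro CollectI allI)
      fix j
      have "real CARD('n) * B \<le> x $ j" "x $ j < real CARD('n) * B + (B1 - 2 * real CARD('n) * B)"
        using x by (auto simp: cube_def)
      moreover have "2 * real CARD('n) * B = real CARD('n) * B + real CARD('n) * B" by simp
      ultimately show "0 \<le> (x - frac_part x + r) $ j \<and> (x - frac_part x + r) $ j < 0 + B1"
        using R_coord[OF that, of j] R_coord[OF fx, of j]
        unfolding vector_add_component vector_minus_component by linarith
    qed
    then show "(x - frac_part x, frac_part x) \<in> T \<times> ?R" using fx diff_rho by (simp add: T_def)
  qed
  moreover have "inj_on (\<lambda>x. (x - frac_part x, frac_part x)) ?In"
    by (rule inj_onI) (metis diff_add_cancel prod.inject)
  ultimately have "card ?In \<le> card (T \<times> ?R)"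
    using finT finite_reps by (intro card_inj_on_le) auto
  then have In: "real (card ?In) \<le> real (card T) * real (card ?R)"
    by (simp add: card_cartesian_product flip: of_nat_mult)

  obtain b where b: "gen {..<CARD('n)} b = L" using exists_generators by blast
  define G where "G = {r \<in> PiE ?I (\<lambda>_. ?R). gen ?I r = L}"
  let ?G = "{ys \<in> PiE ?I (\<lambda>_. ?S). add_subgroup_generated (xs ` {..<CARD('n)} \<union> ys ` ?I) = L}"
  have G: "real (card ?R) ^ (CARD('n) + 1) * ?Z \<le> real (card G)"
    using card_generating_tuples_ge[of "CARD('n)" b ?I] finite_reps unfolding b G_def by (simp add: numeral_2_eq_2)
  define f where "f p = (\<lambda>i\<in>?I. fst p i + snd p i)" for p :: "(nat \<Rightarrow> real ^ 'n) \<times> (nat \<Rightarrow> real ^ 'n)"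
  have "f ` (PiE ?I (\<lambda>_. T) \<times> G) \<subseteq> ?G"
  proof (rule image_subsetI)
    fix p assume p: "p \<in> PiE ?I (\<lambda>_. T) \<times> G"
    define h r where "h = fst p" and "r = snd p"
    have h: "\<And>i. i \<in> ?I \<Longrightarrow> h i \<in> T" and r: "\<And>i. i \<in> ?I \<Longrightarrow> r i \<in> ?R" and g: "gen ?I r = L"
    proof -
      have "h \<in> PiE ?I (\<lambda>_. T)" "r \<in> G"
        using p unfolding h_def r_def by (simp_all add: mem_Times_iff)
      then show "\<And>i. i \<in> ?I \<Longrightarrow> h i \<in> T" "\<And>i. i \<in> ?I \<Longrightarrow> r i \<in> ?R" "gen ?I r = L"
        unfolding G_def by (blast intro: PiE_mem)+
    qed
    have fp: "f p i = h i + r i" if "i \<in> ?I" for i using that by (simp add: f_def h_def r_def)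
    have "f p i \<in> ?S" if "i \<in> ?I" for i
    proof -
      have "h i \<in> L" "r i \<in> L" using h[OF that] r[OF that] sublattice_subset reps_subset by (auto simp: T_def)
      then show ?thesis
        unfolding fp[OF that] using h[OF that] r[OF that] add_subgroup_add[OF subgroup_L] by (simp add: T_def)
    qed
    then have "f p \<in> PiE ?I (\<lambda>_. ?S)" by (auto simp: f_def)
    moreover have "gen ?I (f p) = gen ?I r"
    proof (rule gen_cong)
      fix i assume "i \<in> ?I"
      then show "f p i - r i \<in> sublattice" using h by (simp add: fp T_def)
    qed
    ultimately show "f p \<in> ?G" using g by (simp add: gen_eq)
  qed
  moreover have "inj_on f (PiE ?I (\<lambda>_. T) \<times> G)"
  proof (rule inj_onI)
    fix p q assume p: "p \<in> PiE ?I (\<lambda>_. T) \<times> G" and q: "q \<in> PiE ?I (\<lambda>_. T) \<times> G" and eq: "f p = f q"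
    have P: "fst p \<in> PiE ?I (\<lambda>_. T)" "fst q \<in> PiE ?I (\<lambda>_. T)"
      "snd p \<in> PiE ?I (\<lambda>_. ?R)" "snd q \<in> PiE ?I (\<lambda>_. ?R)"
      using p q unfolding G_def by (simp_all add: mem_Times_iff)
    have mem: "fst p i \<in> T" "fst q i \<in> T" "snd p i \<in> ?R" "snd q i \<in> ?R" if "i \<in> ?I" for i
      using P[THEN PiE_mem, OF that] by simp_all
    have *: "snd p i = snd q i" "fst p i = fst q i" if i: "i \<in> ?I" for i
    proof -
      have e: "fst p i + snd p i = fst q i + snd q i"
        using fun_cong[OF eq, of i] i by (simp add: f_def)
      have "fst q i - fst p i \<in> sublattice"
        using mem[OF i] add_subgroup_diff[OF H] by (simp add: T_def)
      also have "fst q i - fst p i = snd p i - snd q i" using e by (simp add: algebra_simps)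
      finally show "snd p i = snd q i" using reps_eqI mem[OF i] by blast
      then show "fst p i = fst q i" using e by simp
    qed
    have "snd p = snd q"
      by (rule PiE_ext[OF P(3,4) *(1)])
    moreover have "fst p = fst q"
      by (rule PiE_ext[OF P(1,2) *(2)])
    ultimately show "p = q" by (simp add: prod_eq_iff)
  qed
  moreover have finG: "finite ?G"
    by (rule finite_subset[OF _ finite_PiE[of ?I "\<lambda>_. ?S"]]) (auto simp: finS)
  ultimately have "card (PiE ?I (\<lambda>_. T) \<times> G) \<le> card ?G"
    by (intro card_inj_on_le[OF _ _ finG])
  then have TG: "real (card T) ^ (CARD('n) + 1) * real (card G) \<le> real (card ?G)"
    by (simp add: card_cartesian_product card_PiE flip: of_nat_mult of_nat_power)
  have Z: "0 \<le> ?Z"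
    by (intro prod_nonneg) (auto intro!: order_trans[OF zero_le_one zeta_real_ge_1])
  have "real (card ?In) ^ (CARD('n) + 1) * ?Z \<le> (real (card T) * real (card ?R)) ^ (CARD('n) + 1) * ?Z"
    using In Z by (intro mult_right_mono power_mono) auto
  also have "\<dots> = real (card T) ^ (CARD('n) + 1) * (real (card ?R) ^ (CARD('n) + 1) * ?Z)"
    unfolding power_mult_distrib by (simp only: mult.assoc)
  also have "\<dots> \<le> real (card T) ^ (CARD('n) + 1) * real (card G)"
    by (intro mult_left_mono G) auto
  also note TG
  finally show ?thesis .
qed

end

section \<open>Numerical bounds\<close>

text \<open>Telescoping tail bound: from \<open>N\<close> on, partial sum plus \<open>f\<close> is
  nonincreasing, and it converges to the zeta value.\<close>

lemma zeta_real_le_of_tail: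
  fixes f :: "nat \<Rightarrow> real"
  assumes k: "k \<ge> 2" and f: "f \<longlonglongrightarrow> 0" and N: "\<And>m. m \<ge> N \<Longrightarrow> 1 / real (Suc m) ^ k \<le> f m - f (Suc m)"
  shows "zeta_real (real k) \<le> (\<Sum>m<N. 1 / real (Suc m) ^ k) + f N"
proof -
  have "(\<Sum>m<M. 1 / real (Suc m) ^ k) + f M \<le> (\<Sum>m<N. 1 / real (Suc m) ^ k) + f N" if "M \<ge> N" for M
    using that
  proof (induction M rule: dec_induct)
    case (step M)
    then show ?case using N[of M] by simp
  qed simp
  then have "eventually (\<lambda>M. (\<Sum>m<M. 1 / real (Suc m) ^ k) + f M \<le> (\<Sum>m<N. 1 / real (Suc m) ^ k) + f N) sequentially"
    by (auto simp: eventually_sequentially)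
  moreover have "(\<lambda>M. (\<Sum>m<M. 1 / real (Suc m) ^ k) + f M) \<longlonglongrightarrow> zeta_real (real k) + 0"
    using zeta_real_sums[OF k] f unfolding sums_def by (rule tendsto_add)
  ultimately show ?thesis
    using tendsto_upperbound[of _ "zeta_real (real k)" sequentially] by simp
qed

lemma zeta_real_2_le: "zeta_real (real 2) \<le> 165/100"
proof -
  \<comment> \<open>Its differences are \<open>1 / ((m + 1)^2 - 1/4)\<close>, slightly above the
    terms. Two terms and \<open>?f 2\<close> give \<open>1 + 1/4 + 2/5 = 1.65\<close>.\<close>
  let ?f = "\<lambda>m. 1 / (real m + 1/2)"
  have "zeta_real (real 2) \<le> (\<Sum>m<2. 1 / real (Suc m) ^ 2) + ?f 2"
  proof (rule zeta_real_le_of_tail)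
    show "?f \<longlonglongrightarrow> 0" by real_asymp
    fix m :: nat
    have "?f m - ?f (Suc m) = 1 / ((real m + 1/2) * (real m + 3/2))"
      by (simp add: divide_simps) (simp add: algebra_simps)?
    also have "\<dots> \<ge> 1 / real (Suc m) ^ 2"
    proof (rule divide_left_mono)
      show "(real m + 1/2) * (real m + 3/2) \<le> real (Suc m) ^ 2"
        by (simp add: power2_eq_square algebra_simps)
      show "0 < real (Suc m) ^ 2 * ((real m + 1/2) * (real m + 3/2))"
        by (intro mult_pos_pos zero_less_power) auto
    qed simp
    finally show "1 / real (Suc m) ^ 2 \<le> ?f m - ?f (Suc m)" .
  qed simp
  then show ?thesis by (simp add: numeral_2_eq_2)
qed

lemma zeta_real_3_le: "zeta_real (real 3) \<le> 12038/10000"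
proof -
  \<comment> \<open>Its differences are \<open>1 / ((m + 1)^3 - (m + 1))\<close>. Three terms and
    \<open>?f 3\<close> give \<open>1 + 1/8 + 1/27 + 1/24\<close>, just below 1.2038.\<close>
  let ?f = "\<lambda>m. 1 / (2 * real m * (real m + 1))"
  have "zeta_real (real 3) \<le> (\<Sum>m<3. 1 / real (Suc m) ^ 3) + ?f 3"
  proof (rule zeta_real_le_of_tail)
    show "?f \<longlonglongrightarrow> 0" by real_asymp
    fix m :: nat assume m: "m \<ge> 3"
    have "?f m - ?f (Suc m) = 1 / (real m * (real m + 1) * (real m + 2))"
      using m by (simp add: divide_simps) (simp add: algebra_simps)?
    also have "\<dots> \<ge> 1 / real (Suc m) ^ 3"
    proof (rule divide_left_mono)
      show "real m * (real m + 1) * (real m + 2) \<le> real (Suc m) ^ 3"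
        by (simp add: power3_eq_cube algebra_simps)
      show "0 < real (Suc m) ^ 3 * (real m * (real m + 1) * (real m + 2))"
        using m by (intro mult_pos_pos zero_less_power) auto
    qed simp
    finally show "1 / real (Suc m) ^ 3 \<le> ?f m - ?f (Suc m)" .
  qed simp
  then show ?thesis by (simp add: numeral_3_eq_3)
qed

text \<open>Terms with base at least 3 shrink by at least \<open>(1/3) ^ (i - 3)\<close> when the
  exponent rises from 3 to \<open>i\<close>; \<open>9/8\<close> is the sum of the first two terms of
  the series at 3.\<close>

lemma zeta_real_minus_1_le:
  assumes "i \<ge> 3"
  shows "zeta_real (real i) - 1 \<le> 1 / 2 ^ i + (1 / 3) ^ (i - 3) * (12038/10000 - 9/8)"
proof -
  let ?c = "(1 / 3 :: real) ^ (i - 3)"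
  have "(\<lambda>m. 1 / real (Suc m) ^ 3) sums zeta_real (real 3)" by (rule zeta_real_sums) simp
  then have "(\<lambda>m. 1 / real (Suc (m + 2)) ^ 3) sums (zeta_real (real 3) - (\<Sum>m<2. 1 / real (Suc m) ^ 3))"
    by (rule sums_split_initial_segment)
  then have s3: "(\<lambda>m. ?c * (1 / real (Suc (m + 2)) ^ 3)) sums (?c * (zeta_real (real 3) - (\<Sum>m<2. 1 / real (Suc m) ^ 3)))"
    by (rule sums_mult)
  have "(\<lambda>m. 1 / real (Suc m) ^ i) sums zeta_real (real i)" by (rule zeta_real_sums) (use assms in simp)
  then have si: "(\<lambda>m. 1 / real (Suc (m + 2)) ^ i) sums (zeta_real (real i) - (\<Sum>m<2. 1 / real (Suc m) ^ i))"
    by (rule sums_split_initial_segment)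
  have "zeta_real (real i) - (\<Sum>m<2. 1 / real (Suc m) ^ i)
      \<le> ?c * (zeta_real (real 3) - (\<Sum>m<2. 1 / real (Suc m) ^ 3))"
  proof (rule sums_le[OF _ si s3])
    fix m
    have "real (Suc (m + 2)) ^ i = real (Suc (m + 2)) ^ 3 * real (Suc (m + 2)) ^ (i - 3)"
      using assms by (simp flip: power_add)
    moreover have "(3 :: real) ^ (i - 3) \<le> real (Suc (m + 2)) ^ (i - 3)"
      by (intro power_mono) auto
    ultimately show "1 / real (Suc (m + 2)) ^ i \<le> ?c * (1 / real (Suc (m + 2)) ^ 3)"
      by (simp add: power_one_over divide_simps mult_left_mono del: of_nat_Suc)
  qed
  also have "\<dots> \<le> ?c * (12038/10000 - 9/8)"
    using zeta_real_3_le by (intro mult_left_mono) (auto simp: numeral_2_eq_2)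
  finally show ?thesis by (simp add: numeral_2_eq_2)
qed

text \<open>The Weierstrass product inequality.\<close>

lemma prod_one_minus_ge:
  fixes x :: "'a \<Rightarrow> real"
  assumes "finite A" "\<And>i. i \<in> A \<Longrightarrow> 0 \<le> x i \<and> x i \<le> 1"
  shows "1 - (\<Sum>i\<in>A. x i) \<le> (\<Prod>i\<in>A. 1 - x i)"
  using assms
proof (induction A rule: finite_induct)
  case (insert a A)
  have "(\<Prod>i\<in>A. 1 - x i) \<le> 1" using insert.prems by (intro prod_le_1) auto
  then have "x a * (\<Prod>i\<in>A. 1 - x i) \<le> x a" using insert.prems by (intro mult_left_le) auto
  then show ?case using insert by (simp add: algebra_simps)
qed simp

lemma inverse_zeta_prod_ge: "(\<Prod>i = 2..n + 1. 1 / zeta_real (real i)) \<ge> 41/100"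
proof -
  let ?z = "\<lambda>i::nat. 1 / zeta_real (real i)"
  have z01: "0 \<le> ?z i \<and> ?z i \<le> 1" if "i \<ge> 2" for i
    using zeta_real_ge_1[OF that] by simp
  define x where "x i = 1 - ?z i" for i :: nat
  \<comment> \<open>At \<open>i = 4\<close> the bound is
    \<open>1/16 + (12038/10000 - 9/8) / 3\<close>, just below \<open>0.08877\<close>. Powers of
    \<open>1/3\<close> are weakened to powers of \<open>1/2\<close> so that the tail is a geometric
    sum below twice this constant.\<close>
  have x_le: "x i \<le> 8877/100000 * (1/2) ^ (i - 4)" if i: "i \<ge> 4" for i
  proof -
    have z1: "zeta_real (real i) \<ge> 1" using zeta_real_ge_1 i by simp
    then have "x i = (zeta_real (real i) - 1) / zeta_real (real i)"
      by (simp add: x_def field_simps)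
    also have "\<dots> \<le> (zeta_real (real i) - 1) / 1" using z1 by (intro divide_left_mono) auto
    finally have "x i \<le> zeta_real (real i) - 1" by simp
    also have "\<dots> \<le> 1 / 2 ^ i + (1 / 3) ^ (i - 3) * (12038/10000 - 9/8)"
      using i by (intro zeta_real_minus_1_le) simp
    also have "1 / 2 ^ i = 1/16 * (1/2 :: real) ^ (i - 4)"
      using i power_add[of "1/2 :: real" 4 "i - 4"] by (simp add: power_one_over)
    also have "(1 / 3 :: real) ^ (i - 3) = 1/3 * (1/3) ^ (i - 4)"
    proof -
      have "i - 3 = Suc (i - 4)" using i by simp
      then show ?thesis by simp
    qed
    also have "1/16 * (1/2) ^ (i - 4) + 1/3 * (1/3) ^ (i - 4) * (12038/10000 - 9/8)
        \<le> 1/16 * (1/2) ^ (i - 4) + 1/3 * (1/2 :: real) ^ (i - 4) * (12038/10000 - 9/8)"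
      by (intro add_left_mono mult_right_mono mult_left_mono power_mono) auto
    also have "\<dots> \<le> 8877/100000 * (1/2) ^ (i - 4)" by simp
    finally show ?thesis .
  qed
  have tail: "(\<Prod>i = 4..m + 3. ?z i) \<ge> 1 - 2 * (8877/100000)" for m
  proof -
    have "(\<Sum>i = 4..m + 3. x i) \<le> (\<Sum>i = 4..m + 3. 8877/100000 * (1/2) ^ (i - 4))"
      by (intro sum_mono x_le) auto
    also have "\<dots> = 8877/100000 * (\<Sum>i<m. (1/2) ^ i)"
    proof -
      have "(\<Sum>i = 4..m + 3. (1/2 :: real) ^ (i - 4)) = (\<Sum>i<m. (1/2) ^ i)"
        by (rule sum.reindex_bij_witness[of _ "\<lambda>i. i + 4" "\<lambda>i. i - 4"]) auto
      then show ?thesis unfolding sum_distrib_left[symmetric] by simp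
    qed
    also have "(\<Sum>i<m. (1/2 :: real) ^ i) \<le> 2"
      by (simp add: sum_gp_strict)
    finally have "1 - 2 * (8877/100000) \<le> 1 - (\<Sum>i = 4..m + 3. x i)" by simp
    also have "\<dots> \<le> (\<Prod>i = 4..m + 3. 1 - x i)"
      using z01 by (intro prod_one_minus_ge) (auto simp: x_def)
    finally show ?thesis by (simp add: x_def)
  qed
  have split: "(\<Prod>i = 2..m + 3. ?z i) = ?z 2 * ?z 3 * (\<Prod>i = 4..m + 3. ?z i)" for m
  proof -
    have "{2..m + 3} = insert 2 (insert 3 {4..m + 3})" by auto
    then show ?thesis by simp
  qed
  have "1 / (165/100) * (1 / (12038/10000)) * (1 - 2 * (8877/100000)) \<le> (\<Prod>i = 2..n + 3. ?z i)"
    unfolding split using tail[of n] zeta_real_2_le zeta_real_3_le zeta_real_ge_1[of 2] zeta_real_ge_1[of 3]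
    by (intro mult_mono divide_left_mono) auto
  \<comment> \<open>Working up to \<open>n + 3\<close> makes the factors at 2 and 3 present for
    every \<open>n\<close>; dropping the two last factors, which are at most 1, only increases the
    product.\<close>
  also have "(\<Prod>i = 2..n + 3. ?z i) \<le> (\<Prod>i = 2..n + 1. ?z i)"
  proof -
    have "{2..n + 3} = {2..n + 1} \<union> {n + 2, n + 3}" by auto
    then have "(\<Prod>i = 2..n + 3. ?z i) = (\<Prod>i = 2..n + 1. ?z i) * (?z (n + 2) * ?z (n + 3))"
      by (simp add: prod.union_disjoint)
    also have "\<dots> \<le> (\<Prod>i = 2..n + 1. ?z i) * 1"
      using z01[of "n + 2"] z01[of "n + 3"] z01 by (intro mult_left_mono mult_le_one prod_nonneg) auto
    finally show ?thesis by simp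
  qed
  finally show ?thesis by simp
qed

text \<open>The bound \<open>4/5\<close>, from \<open>zeta(2) >= 1 + 1/4\<close>, is exactly what
  makes \<open>Z - 1/4 <= 11/16 * Z\<close> hold for the zeta product \<open>Z\<close>.\<close>

lemma inverse_zeta_prod_le:
  assumes "n \<ge> 1"
  shows "(\<Prod>i = 2..n + 1. 1 / zeta_real (real i)) \<le> 4/5"
proof -
  let ?z = "\<lambda>i::nat. 1 / zeta_real (real i)"
  have z01: "0 \<le> ?z i \<and> ?z i \<le> 1" if "i \<ge> 2" for i
    using zeta_real_ge_1[OF that] by simp
  have "5/4 \<le> zeta_real (real 2)"
    using zeta_real_ge_partial_sum[of 2 2] by (simp add: numeral_2_eq_2)
  then have "?z 2 \<le> 4/5" by (simp add: field_simps)
  moreover have "(\<Prod>i = 3..n + 1. ?z i) \<le> 1"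
    by (rule prod_le_1) (rule z01, simp)
  moreover have "0 \<le> (\<Prod>i = 3..n + 1. ?z i)"
    by (rule prod_nonneg) (rule z01[THEN conjunct1], simp)
  moreover have "(\<Prod>i = 2..n + 1. ?z i) = ?z 2 * (\<Prod>i = 3..n + 1. ?z i)"
  proof -
    have "{2..n + 1} = insert 2 {3..n + 1}" using assms by auto
    then show ?thesis by simp
  qed
  ultimately show ?thesis using mult_mono[of "?z 2" "4/5" "\<Prod>i = 3..n + 1. ?z i" 1] by simp
qed

text \<open>Bounds the probability that a random vector lies in the span of \<open>k\<close>
  independent earlier ones. It is \<open>sqrt n ^ k * (v + 1) ^ k / (v - 1) ^ n\<close>, where
  \<open>v = 4 * n ^ (n / 2)\<close> is the smallest admissible value of \<open>B\<close> divided by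
  twice the covering radius.\<close>

definition dep_ratio :: "nat \<Rightarrow> nat \<Rightarrow> real" where
  "dep_ratio n k = real n powr (real k / 2) *
        (4 * real n powr (real n / 2) + 1) ^ k / (4 * real n powr (real n / 2) - 1) ^ n"

lemma alpha_const_eq:
  "alpha_const n = ((\<Prod>i = 2..n + 1. 1 / zeta_real (real i)) - 1/4) * (\<Prod>k<n. 1 - dep_ratio n k)"
  by (simp add: alpha_const_def dep_ratio_def)

lemma powr_half:
  assumes "n \<ge> 1"
  shows "real n powr (real k / 2) = sqrt (real n) ^ k"
proof -
  have "real n powr (real k / 2) = (real n powr (1 / 2)) powr real k"
    by (simp add: powr_powr)
  then show ?thesis using assms by (simp add: powr_half_sqrt powr_realpow)
qed

lemma dep_ratio_nonneg:
  assumes "n \<ge> 1"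
  shows "0 \<le> dep_ratio n k"
proof -
  have *: "sqrt (real n) ^ n \<ge> 1" using assms by (intro one_le_power) simp
  show ?thesis
    unfolding dep_ratio_def powr_half[OF assms]
    by (intro divide_nonneg_nonneg mult_nonneg_nonneg zero_le_power add_nonneg_nonneg) (use * in auto)
qed

text \<open>A geometric sum with ratio \<open>q = s * (u + 1)\<close>, at most
  \<open>1 / (4 * s)\<close> times \<open>((u + 1) / (u - 1)) ^ n\<close>, hence at most
  \<open>1 / (2 * s)\<close>. For \<open>n >= 2\<close> this is below \<open>5/12\<close>; for
  \<open>n = 1\<close> it would only give \<open>1/2\<close>, while the sum is
  \<open>1/3\<close>.\<close>

lemma sum_dep_ratio_le:
  assumes n: "n \<ge> 1"
  shows "(\<Sum>k<n. dep_ratio n k) \<le> 5/12"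
proof (cases "n = 1")
  case True
  then show ?thesis by (simp add: dep_ratio_def)
next
  case False
  then have n2: "n \<ge> 2" using n by simp
  define s where "s = sqrt (real n)"
  define u where "u = 4 * s ^ n"
  have s1: "s \<ge> 1" using n by (simp add: s_def)
  have s2: "s * s = real n" by (simp add: s_def)
  have sn: "s ^ n \<ge> real n"
    using power_increasing[OF n2 s1] s2 by (simp add: power2_eq_square)
  have u: "u \<ge> 4 * real n" "u > 1" using sn n by (auto simp: u_def)
  define q where "q = s * (u + 1)"
  have q1: "q > 1" using s1 u mult_mono[of 1 s 2 "u + 1"] by (simp add: q_def)
  have "(\<Sum>k<n. dep_ratio n k) = (\<Sum>k<n. q ^ k) / (u - 1) ^ n"
    using n by (simp add: dep_ratio_def powr_half u_def s_def q_def power_mult_distrib sum_divide_distrib)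
  also have "(\<Sum>k<n. q ^ k) = (q ^ n - 1) / (q - 1)"
    using q1 geometric_sum[of q n] by simp
  also have "(q ^ n - 1) / (q - 1) / (u - 1) ^ n \<le> q ^ n / (s * u) / (u - 1) ^ n"
  proof -
    have "s * u \<le> q - 1" using s1 by (simp add: q_def algebra_simps)
    then show ?thesis using q1 u s1 by (intro divide_right_mono frac_le) auto
  qed
  also have "\<dots> = s ^ n / (s * u) * ((u + 1) / (u - 1)) ^ n"
    by (simp add: q_def power_mult_distrib power_divide)
  also have "s ^ n / (s * u) = 1 / (4 * s)" using s1 by (simp add: u_def)
  also have "1 / (4 * s) * ((u + 1) / (u - 1)) ^ n \<le> 1 / (4 * s) * 2"
  proof -
    \<comment> \<open>Bernoulli applied to the inverse ratio \<open>1 - 2 / (u + 1)\<close>; since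
      \<open>u >= 4 * n\<close>, the total loss is at most \<open>1/2\<close>.\<close>
    have "1/2 \<le> 1 - real n * (2 / (u + 1))" using u by (simp add: field_simps)
    also have "\<dots> \<le> (1 - 2 / (u + 1)) ^ n"
      using u Bernoulli_inequality[of "- 2 / (u + 1)" n] by (simp add: field_simps)
    also have "1 - 2 / (u + 1) = (u - 1) / (u + 1)" using u by (simp add: field_simps)
    finally have "1 / ((u - 1) / (u + 1)) ^ n \<le> 2" using u by (simp add: field_simps)
    then have "((u + 1) / (u - 1)) ^ n \<le> 2" by (simp add: power_divide)
    then show ?thesis using s1 by (intro mult_left_mono) auto
  qed
  also have "1 / (4 * s) * 2 \<le> 5/12"
  proof -
    \<comment> \<open>\<open>6/5\<close> is a rational lower bound for \<open>sqrt 2\<close>, and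
      \<open>1 / (2 * (6/5)) = 5/12\<close>.\<close>
    have "(6/5)\<^sup>2 \<le> s\<^sup>2" using n2 s2 by (simp add: power2_eq_square)
    then have "6/5 \<le> s" by (rule power2_le_imp_le) (use s1 in simp)
    then show ?thesis by (simp add: field_simps)
  qed
  finally show ?thesis .
qed

lemma dep_ratio_le_1:
  assumes "n \<ge> 1" "k < n"
  shows "dep_ratio n k \<le> 1"
proof -
  have "dep_ratio n k \<le> (\<Sum>k<n. dep_ratio n k)"
    using assms dep_ratio_nonneg by (intro member_le_sum) auto
  then show ?thesis using sum_dep_ratio_le[OF assms(1)] by simp
qed

lemma alpha_const_ge:
  assumes n: "n \<ge> 1"
  shows "alpha_const n \<ge> 0.092"
proof -
  have "7/12 \<le> 1 - (\<Sum>k<n. dep_ratio n k)" using sum_dep_ratio_le[OF n] by simp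
  also have "\<dots> \<le> (\<Prod>k<n. 1 - dep_ratio n k)"
    using n dep_ratio_nonneg dep_ratio_le_1 by (intro prod_one_minus_ge) auto
  \<comment> \<open>The left-hand side is \<open>0.0933...\<close>.\<close>
  finally have "(41/100 - 1/4) * (7/12) \<le> alpha_const n"
    unfolding alpha_const_eq using inverse_zeta_prod_ge[of n] by (intro mult_mono) auto
  then show ?thesis by simp
qed

section \<open>The probability of generating the lattice\<close>

text \<open>Reduces any admissible \<open>B\<close> to the smallest one:
  \<open>(x + 1) / (x - 1)\<close> decreases in \<open>x\<close>, and the remaining
  \<open>n - k\<close> factors \<open>1 / (x - 1)\<close> do so too.\<close>

lemma ratio_power_antimono:
  fixes u v :: real
  assumes "1 < v" "v \<le> u" "k \<le> n"
  shows "(u + 1) ^ k / (u - 1) ^ n \<le> (v + 1) ^ k / (v - 1) ^ n"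
proof -
  have "((u + 1) * (v - 1)) ^ k * (v - 1) ^ (n - k) \<le> ((v + 1) * (u - 1)) ^ k * (u - 1) ^ (n - k)"
  proof -
    have "(u + 1) * (v - 1) \<le> (v + 1) * (u - 1)" using assms by (simp add: algebra_simps)
    then have "((u + 1) * (v - 1)) ^ k \<le> ((v + 1) * (u - 1)) ^ k" using assms by (intro power_mono) auto
    moreover have "(v - 1) ^ (n - k) \<le> (u - 1) ^ (n - k)" using assms by (intro power_mono) auto
    ultimately show ?thesis using assms by (intro mult_mono) auto
  qed
  moreover have "x ^ n = x ^ k * x ^ (n - k)" for x :: real
    using assms(3) by (simp only: le_add_diff_inverse flip: power_add)
  ultimately have "(u + 1) ^ k * (v - 1) ^ n \<le> (v + 1) ^ k * (u - 1) ^ n"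
    by (simp only: power_mult_distrib mult_ac)
  moreover have "0 < (u - 1) ^ n" "0 < (v - 1) ^ n" using assms by auto
  ultimately show ?thesis by (simp only: pos_divide_le_eq times_divide_eq_left pos_le_divide_eq)
qed

text \<open>Divides the upper count for a subspace by the lower count for the cube. The cell volume
  cancels, and measuring lengths in units of twice the covering radius leaves a function of
  \<open>u = B / (2 * r)\<close>, which is at least \<open>v\<close>.\<close>

lemma card_lattice_span_le_dep_ratio:
  fixes L :: "(real ^ 'n) set"
  assumes L: "full_rank_lattice L"
    and B: "B \<ge> 8 * real CARD('n) powr (real CARD('n) / 2) * covering_radius L"
    and V: "subspace V" "dim V < CARD('n)"
  shows "real (card (L \<inter> cube 0 B \<inter> V)) \<le> dep_ratio CARD('n) (dim V) * real (card (L \<inter> cube 0 B))"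
proof -
  define n k where "n = CARD('n)" and "k = dim V"
  define r d where "r = covering_radius L" and "d = measure lebesgue (voronoi_cell L)"
  have r: "r > 0" and d: "d > 0"
    unfolding r_def d_def by (rule covering_radius_pos[OF L], rule covolume_pos[OF L])
  have n: "n \<ge> 1" and k: "k \<le> n" using V by (simp_all add: n_def k_def Suc_leI)
  define v where "v = 4 * sqrt (real n) ^ n"
  have "sqrt (real n) ^ n \<ge> 1" using n by (intro one_le_power) simp
  then have v: "v \<ge> 4" by (simp add: v_def)
  define u where "u = B / (2 * r)"
  have "8 * sqrt (real n) ^ n * r \<le> B"
    using B powr_half[OF n, of n] by (simp add: n_def r_def)
  then have vu: "v \<le> u" using r by (simp add: u_def v_def field_simps)
  have Bu: "B = u * (2 * r)" using r by (simp add: u_def)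
  have B0: "0 \<le> B" using vu v r unfolding Bu by simp
  have "real (card (L \<inter> V \<inter> cube 0 B)) * d \<le> (sqrt (real n) * (B + 2 * r)) ^ k * (2 * r) ^ (n - k)"
    unfolding n_def k_def r_def d_def by (rule card_lattice_subspace_cube_le[OF L V(1) B0])
  also have "\<dots> = sqrt (real n) ^ k * (u + 1) ^ k * (2 * r) ^ n"
  proof -
    have "B + 2 * r = (u + 1) * (2 * r)" by (simp add: Bu algebra_simps)
    moreover have "(2 * r) ^ n = (2 * r) ^ k * (2 * r) ^ (n - k)" 
      using k by (simp only: le_add_diff_inverse flip: power_add)
    ultimately show ?thesis by (simp add: power_mult_distrib)
  qed
  finally have up: "real (card (L \<inter> V \<inter> cube 0 B)) * d \<le> sqrt (real n) ^ k * (u + 1) ^ k * (2 * r) ^ n" .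
  have "2 * r \<le> B" unfolding Bu using r vu v by simp
  then have "(B - 2 * r) ^ n \<le> real (card (L \<inter> cube 0 B)) * d"
    unfolding n_def r_def d_def by (intro card_lattice_cube_ge[OF L])
  moreover have "B - 2 * r = (u - 1) * (2 * r)" by (simp add: Bu algebra_simps)
  ultimately have low: "(u - 1) ^ n * (2 * r) ^ n \<le> real (card (L \<inter> cube 0 B)) * d"
    by (simp only: power_mult_distrib)
  have u1: "(u - 1) ^ n > 0" using vu v by simp
  have "dep_ratio n k = sqrt (real n) ^ k * ((v + 1) ^ k / (v - 1) ^ n)"
    by (simp add: dep_ratio_def powr_half[OF n] v_def)
  moreover have "(u + 1) ^ k / (u - 1) ^ n \<le> (v + 1) ^ k / (v - 1) ^ n"
    using v by (intro ratio_power_antimono vu k) simp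
  ultimately have ratio: "sqrt (real n) ^ k * ((u + 1) ^ k / (u - 1) ^ n) \<le> dep_ratio n k"
    by (simp only:) (rule mult_left_mono, auto)
  have "real (card (L \<inter> V \<inter> cube 0 B)) * d
      \<le> sqrt (real n) ^ k * ((u + 1) ^ k / (u - 1) ^ n) * ((u - 1) ^ n * (2 * r) ^ n)"
  proof -
    have "sqrt (real n) ^ k * ((u + 1) ^ k / (u - 1) ^ n) * ((u - 1) ^ n * (2 * r) ^ n)
        = sqrt (real n) ^ k * (u + 1) ^ k * (2 * r) ^ n"
      using vu v by simp
    then show ?thesis using up by (simp only:)
  qed
  also have "\<dots> \<le> dep_ratio n k * (real (card (L \<inter> cube 0 B)) * d)"
    by (rule mult_mono[OF ratio low]) (use u1 r dep_ratio_nonneg[OF n] in auto)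
  finally have "real (card (L \<inter> V \<inter> cube 0 B)) \<le> dep_ratio n k * real (card (L \<inter> cube 0 B))"
    using d by (simp flip: mult.assoc)
  moreover have "L \<inter> V \<inter> cube 0 B = L \<inter> cube 0 B \<inter> V" by blast
  ultimately show ?thesis by (simp add: n_def k_def)
qed

text \<open>The ratio of the two counts is at least \<open>(c / a) ^ n\<close>, and its power for
  \<open>n + 1\<close> vectors is \<open>(1 - e / a) ^ (n * (n + 1))\<close>; Bernoulli bounds this
  from below by \<open>1 - 5/16\<close>.\<close>

lemma card_inner_cube_ge:
  fixes L :: "(real ^ 'n) set" and B B1 :: real
  assumes L: "full_rank_lattice L" and B: "B \<ge> 8 * covering_radius L"
    and B1: "B1 \<ge> 8 * (real CARD('n))\<^sup>2 * (real CARD('n) + 1) * B"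
  shows "11/16 * real (card (L \<inter> cube 0 B1)) ^ (CARD('n) + 1)
    \<le> real (card (L \<inter> cube (real CARD('n) * B) (B1 - 2 * real CARD('n) * B))) ^ (CARD('n) + 1)"
proof -
  define n where "n = CARD('n)"
  define r d where "r = covering_radius L" and "d = measure lebesgue (voronoi_cell L)"
  have r: "r > 0" and d: "d > 0"
    unfolding r_def d_def by (rule covering_radius_pos[OF L], rule covolume_pos[OF L])
  have n: "real n \<ge> 1" by (simp add: n_def Suc_leI)
  define N M where "N = real (card (L \<inter> cube 0 B1))"
    and "M = real (card (L \<inter> cube (real n * B) (B1 - 2 * real n * B)))"
  have Br: "8 * r \<le> B" using B by (simp add: r_def)
  have nB: "B \<le> real n * B" using mult_right_mono[OF n, of B] Br r by simp
  \<comment> \<open>The gap between the large side widened by \<open>2 * r\<close> and the inner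
    side narrowed by \<open>2 * r\<close>. From \<open>8 * r <= B <= n * B\<close> it is at most
    \<open>5/2 * n * B\<close>, which the hypothesis on \<open>B1\<close> turns into
    \<open>n * (n + 1) * e <= 5/16 * B1\<close>.\<close>
  define e where "e = 2 * (real n * B) + 4 * r"
  have e: "e \<le> 5/2 * (real n * B)" "0 \<le> e"
    unfolding e_def using Br nB r by linarith+
  have "real n * (real n + 1) * e \<le> real n * (real n + 1) * (5/2 * (real n * B))"
    using e n by (intro mult_left_mono) auto
  also have "\<dots> = 5/16 * (8 * (real n)\<^sup>2 * (real n + 1) * B)"
    by (simp add: power2_eq_square algebra_simps)
  also have "\<dots> \<le> 5/16 * B1"
    unfolding n_def by (rule mult_left_mono[OF B1]) simp
  finally have ne: "real n * (real n + 1) * e \<le> 5/16 * B1" .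
  have e_le: "e \<le> real n * (real n + 1) * e"
    using mult_mono[of 1 "real n" 1 "real n + 1"] n e mult_right_mono[of 1 "real n * (real n + 1)" e] by simp
  have B1p: "0 < B1" 
  proof -
    have "0 < e" unfolding e_def using nB Br r by linarith
    then show ?thesis using ne e_le by linarith
  qed
  define a c where "a = B1 + 2 * r" and "c = B1 - 2 * real n * B - 2 * r"
  have ca: "c = a - e" by (simp add: a_def c_def e_def)
  have a: "a > 0" "B1 \<le> a" using B1p r by (auto simp: a_def)
  have c: "c > 0" using ne e_le a B1p unfolding ca a_def using r by linarith
  have "N * d \<le> a ^ n"
    unfolding N_def d_def n_def a_def r_def using B1p by (intro card_lattice_cube_le[OF L]) simp
  moreover have "c ^ n \<le> M * d"
    using card_lattice_cube_ge[OF L, of "B1 - 2 * real n * B" "real n * B"] c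
    by (simp add: M_def d_def n_def c_def r_def)
  ultimately have "c ^ n * (N * d) \<le> (M * d) * a ^ n"
    using c d by (intro mult_mono) (auto simp: M_def N_def)
  then have "(c / a) ^ n * N \<le> M"
    using d a by (simp add: power_divide field_simps)
  then have "((c / a) ^ n * N) ^ (n + 1) \<le> M ^ (n + 1)"
    using c a by (intro power_mono) (auto simp: N_def)
  then have MN: "(c / a) ^ (n * (n + 1)) * N ^ (n + 1) \<le> M ^ (n + 1)"
    by (simp only: power_mult_distrib power_mult)
  have "real (n * (n + 1)) = real n * (real n + 1)" by (simp only: of_nat_mult of_nat_add of_nat_1)
  then have "real (n * (n + 1)) * e \<le> 5/16 * a" using ne a by simp
  then have "real (n * (n + 1)) * (e / a) \<le> 5/16" using a by (simp add: field_simps)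
  then have "11/16 \<le> 1 + real (n * (n + 1)) * (- (e / a))" by simp
  also have "\<dots> \<le> (1 + - (e / a)) ^ (n * (n + 1))"
    using c a unfolding ca by (intro Bernoulli_inequality) (simp add: field_simps)
  also have "1 + - (e / a) = c / a" using a by (simp add: ca field_simps)
  finally have "11/16 * N ^ (n + 1) \<le> (c / a) ^ (n * (n + 1)) * N ^ (n + 1)"
    by (intro mult_right_mono) (auto simp: N_def)
  also note MN
  finally show ?thesis by (simp add: N_def M_def n_def)
qed

theorem theorem1p1:
  fixes L :: "(real ^ 'n) set" and B B1 :: real
  assumes "full_rank_lattice L"
    and "B \<ge> 8 * real CARD('n) powr (real CARD('n) / 2) * covering_radius L"
    and "B1 \<ge> 8 * (real CARD('n))^2 * (real CARD('n) + 1) * B"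
  shows "measure_pmf.prob
           (pmf_of_set ((PiE {..<CARD('n)} (\<lambda>_. L \<inter> box0 B)) \<times>
                        (PiE {..<CARD('n)+1} (\<lambda>_. L \<inter> box0 B1))))
           {(xs, ys). add_subgroup_generated (xs ` {..<CARD('n)} \<union> ys ` {..<CARD('n)+1}) = L}
         \<ge> alpha_const CARD('n)
       \<and> alpha_const CARD('n) \<ge> 0.092"
proof
  let ?n = "CARD('n)"
  note L = assms(1)
  have n: "?n \<ge> 1" by (simp add: Suc_leI)
  show "alpha_const ?n \<ge> 0.092" by (rule alpha_const_ge[OF n])
  define S S1 where "S = L \<inter> cube 0 B" and "S1 = L \<inter> cube 0 B1"
  define Z where "Z = (\<Prod>i = 2..?n + 1. 1 / zeta_real (real i))"
  define P where "P = (\<Prod>k<?n. 1 - dep_ratio ?n k)"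
  define E where "E = {(xs, ys). add_subgroup_generated (xs ` {..<?n} \<union> ys ` {..<?n+1}) = L}"
  define X where "X = PiE {..<?n} (\<lambda>_. S)"
  define Y where "Y = PiE {..<?n + 1} (\<lambda>_. S1)"
  have Z: "41/100 \<le> Z" "Z \<le> 4/5"
    unfolding Z_def by (rule inverse_zeta_prod_ge, rule inverse_zeta_prod_le[OF n])
  have P: "0 \<le> P"
    unfolding P_def using dep_ratio_le_1[OF n] by (intro prod_nonneg) auto
  have r: "covering_radius L > 0" by (rule covering_radius_pos[OF L])
  have "sqrt (real ?n) ^ ?n \<ge> 1" using n by (intro one_le_power) simp
  then have "real ?n powr (real ?n / 2) \<ge> 1" using powr_half[OF n, of ?n] by simp
  then have "8 * 1 * covering_radius L \<le> 8 * real ?n powr (real ?n / 2) * covering_radius L"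
    using r by (intro mult_right_mono mult_left_mono) auto
  then have Br: "8 * covering_radius L \<le> B" using assms(2) by simp
  then have B0: "0 < B" using r by simp
  then have "0 < 8 * (real ?n)\<^sup>2 * (real ?n + 1) * B" by (intro mult_pos_pos) auto
  then have B10: "0 < B1" using assms(3) by (rule less_le_trans)
  have fin: "finite S" "finite S1"
    unfolding S_def S1_def by (rule full_rank_lattice_finite_Int[OF L bounded_cube])+
  \<comment> \<open>The origin belongs to both half-open cubes, so the sample space is nonempty and
    the uniform distribution on it is meaningful.\<close>
  have zero: "0 \<in> S" "0 \<in> S1"
    using add_subgroup_0[OF full_rank_lattice_subgroup[OF L]] B0 B10 by (auto simp: S_def S1_def cube_def)
  have finX: "finite X" and finY: "finite Y"
    unfolding X_def Y_def using fin by (auto intro!: finite_PiE)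
  have cX: "card X = card S ^ ?n" and cY: "card Y = card S1 ^ (?n + 1)"
    unfolding X_def Y_def by (simp_all add: card_PiE)
  have c0: "0 < card S" "0 < card S1" using fin zero by (auto simp: card_gt_0_iff)
  have ne: "X \<times> Y \<noteq> {}" using finX finY cX cY c0 by (metis card.empty card_cartesian_product mult_eq_0_iff power_not_zero less_numeral_extra(3))

  define G where "G = {xs \<in> X. indep_seq xs ?n}"
  have G: "real (card S) ^ ?n * P \<le> real (card G)"
    unfolding G_def P_def X_def
  proof (rule card_indep_seqs_ge[OF fin(1)])
    fix k and xs :: "nat \<Rightarrow> real ^ 'n"
    assume k: "k < ?n" "indep_seq xs k"
    then show "real (card (S \<inter> span (xs ` {..<k}))) \<le> dep_ratio ?n k * real (card S)"
      using card_lattice_span_le_dep_ratio[OF L assms(2), of "span (xs ` {..<k})"]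
      unfolding indep_seq_dim[OF k(2)] S_def by simp
  qed (use dep_ratio_le_1[OF n] in auto)
  \<comment> \<open>For each independent first tuple \<open>xs\<close>, the second tuples that
    complete it to a generating family. Summing their numbers over \<open>G\<close> bounds the event
    from below; dependent first tuples are discarded.\<close>
  define F where "F xs = {ys \<in> Y. (xs, ys) \<in> E}" for xs
  have F: "11/16 * real (card S1) ^ (?n + 1) * Z \<le> real (card (F xs))" if xs: "xs \<in> G" for xs
  proof -
    have mem: "xs i \<in> S" if "i < ?n" for i
      using xs that PiE_mem[of xs "{..<?n}" "\<lambda>_. S" i] unfolding G_def X_def by simp
    interpret sublattice_basis L xs
      by unfold_locales (use L xs mem in \<open>auto simp: G_def S_def\<close>)
    have "11/16 * real (card S1) ^ (?n + 1) * Z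
      \<le> real (card (L \<inter> cube (real ?n * B) (B1 - 2 * real ?n * B))) ^ (?n + 1) * Z"
      using card_inner_cube_ge[OF L Br assms(3)] Z unfolding S1_def by (intro mult_right_mono) auto
    also have "\<dots> \<le> real (card (F xs))"
      using card_generating_tuples_cube_ge[OF B0, of B1] mem
      unfolding F_def E_def Y_def Z_def S_def S1_def by simp
    finally show ?thesis .
  qed
  have finG: "finite G" unfolding G_def using finX by simp
  have finF: "finite (F xs)" for xs unfolding F_def using finY by simp
  have "Sigma G F \<subseteq> (X \<times> Y) \<inter> E" unfolding G_def F_def by blast
  then have "card (Sigma G F) \<le> card ((X \<times> Y) \<inter> E)"
    using finX finY by (intro card_mono) auto
  then have "(\<Sum>xs\<in>G. real (card (F xs))) \<le> real (card ((X \<times> Y) \<inter> E))"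
    using finG finF by (simp add: card_SigmaI flip: of_nat_sum)
  moreover have "real (card G) * (11/16 * real (card S1) ^ (?n + 1) * Z) \<le> (\<Sum>xs\<in>G. real (card (F xs)))"
    using sum_mono[of G "\<lambda>_. 11/16 * real (card S1) ^ (?n + 1) * Z", OF F] by simp
  moreover have "real (card S) ^ ?n * P * (11/16 * real (card S1) ^ (?n + 1) * Z)
      \<le> real (card G) * (11/16 * real (card S1) ^ (?n + 1) * Z)"
    using G Z by (intro mult_right_mono) auto
  ultimately have le: "11/16 * Z * P * (real (card S) ^ ?n * real (card S1) ^ (?n + 1)) \<le> real (card ((X \<times> Y) \<inter> E))"
    by (simp add: mult_ac)
  have "alpha_const ?n = (Z - 1/4) * P" unfolding alpha_const_eq Z_def P_def ..
  \<comment> \<open>Equivalent to \<open>5/16 * Z <= 1/4\<close> up to the factor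
    \<open>P >= 0\<close>, that is, to \<open>Z <= 4/5\<close>: the boundary loss of the large cube
    is traded for the subtracted \<open>1/4\<close>.\<close>
  also have "\<dots> \<le> 11/16 * Z * P" using Z P by (intro mult_right_mono) auto
  also have "\<dots> \<le> real (card ((X \<times> Y) \<inter> E)) / (real (card S) ^ ?n * real (card S1) ^ (?n + 1))"
    using le c0 by (subst pos_le_divide_eq) auto
  also have "\<dots> = real (card ((X \<times> Y) \<inter> E)) / real (card (X \<times> Y))"
    by (simp add: card_cartesian_product cX cY)
  also have "\<dots> = measure_pmf.prob (pmf_of_set (X \<times> Y)) E"
    using ne finX finY by (intro measure_pmf_of_set[symmetric]) auto
  finally show "measure_pmf.prob
           (pmf_of_set ((PiE {..<CARD('n)} (\<lambda>_. L \<inter> box0 B)) \<times>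
                        (PiE {..<CARD('n)+1} (\<lambda>_. L \<inter> box0 B1))))
           {(xs, ys). add_subgroup_generated (xs ` {..<CARD('n)} \<union> ys ` {..<CARD('n)+1}) = L}
         \<ge> alpha_const CARD('n)"
    unfolding X_def Y_def S_def S1_def E_def box0_eq_cube .
qed

end
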